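(* Let $n\ge 2$, $j\ge 1$, $j\not\equiv 0 \pmod n$. Let $\gamma\in\mathcal{M}_n(\mathbb{R})$, and let $g=(\gamma,\gamma_x,\ldots,\gamma_x^{(n-1)})$ and $u$ be its central affine moving frame and central affine curvature. Then $\xi(\gamma)=g\,Z_{j,0}(u)\,e_1$ is tangent to $\mathcal{M}_n(\mathbb{R})$ at $\gamma$. Consequently $\gamma_t=g\,Z_{j,0}(u)\,e_1$ is a flow equation on $\mathcal{M}_n(\mathbb{R})$ (called the $j$-th central affine curve flow).
   Context: $\mathcal{M}_n(\mathbb{R})$ is the set of smooth $\gamma:\mathbb{R}\to\mathbb{R}^n\setminus\{0\}$ with $\det(\gamma,\gamma_x,\ldots,\gamma_x^{(n-1)})=1$, where $\gamma_x^{(i)}=d^i\gamma/dx^i$. For such $\gamma$ the frame $g=(\gamma,\ldots,\gamma_x^{(n-1)})$ satisfies $g_x=g(b+u)$ with $b=\sum_{i=1}^{n-1}e_{i+1,i}$ and $u=\sum_{i=1}^{n-1}u_ie_{in}$, where $\gamma_x^{(n)}=u_1\gamma+\cdots+u_{n-1}\gamma_x^{(n-2)}$; $u$ is the central affine curvature. $V_n=\bigoplus_{i=1}^{n-1}\mathbb{R}e_{in}$, $e_1=(1,0,\ldots,0)^t$. A smooth $X:\mathbb{R}\to\mathbb{R}^n$ is tangent to $\mathcal{M}_n(\mathbb{R})$ at $\gamma$ iff $\sum_{i=0}^{n-1}\det(\gamma,\ldots,\gamma_x^{(i-1)},X_x^{(i)},\gamma_x^{(i+1)},\ldots,\gamma_x^{(n-1)})=0$.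 Let $J=e_{1n}\lambda+b$. For smooth $u:\mathbb{R}\to V_n$, let $Y(u,\lambda)=e_{1n}\lambda+\sum_{i\le 0}Y_{1,i}(u)\lambda^i$ be the unique formal series with smooth $sl(n)$-valued coefficients satisfying $Y_x+[J+u,Y]=0$ and $Y^n=\lambda I_n$; its coefficients are differential polynomials in $u$. Write $Y(u,\lambda)^j=\sum_i Y_{j,i}(u)\lambda^i$. There is a unique $\zeta_j(u)$ with values in the strictly upper triangular matrices (entries differential polynomials in $u$) such that $[\partial_x+b+u,\,Y_{j,0}(u)-\zeta_j(u)]\in V_n$, where $[\partial_x+A,B]=B_x+[A,B]$. Set $Z_{j,0}(u)=Y_{j,0}(u)-\zeta_j(u)$. *)

theory Defs
  imports
    "HOL-Analysis.Derivative"
    "HOL-Computational_Algebra.Formal_Laurent_Series"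
    "Jordan_Normal_Form.Determinant"
begin

text \<open>Matrices and vectors are indexed from 0, so that the \<open>(i,k)\<close> entry of the
  mathematical text is the entry \<open>(i - 1, k - 1)\<close> here. Curves in \<open>\<real>\<^sup>n\<close> and matrix-valued
  functions of \<open>x\<close> are differentiated entrywise.\<close>

definition smooth_fun :: "(real \<Rightarrow> real) \<Rightarrow> bool" where
  "smooth_fun f \<longleftrightarrow> (\<forall>k x. (deriv ^^ k) f field_differentiable at x)"

definition smooth_vec :: "nat \<Rightarrow> (real \<Rightarrow> real vec) \<Rightarrow> bool" where
  "smooth_vec n X \<longleftrightarrow>
     (\<forall>x. X x \<in> carrier_vec n) \<and> (\<forall>i<n. smooth_fun (\<lambda>x. X x $ i))"

definition smooth_mat :: "nat \<Rightarrow> (real \<Rightarrow> real mat) \<Rightarrow> bool" where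
  "smooth_mat n A \<longleftrightarrow>
     (\<forall>x. A x \<in> carrier_mat n n) \<and> (\<forall>i<n. \<forall>k<n. smooth_fun (\<lambda>x. A x $$ (i, k)))"

definition vec_deriv :: "nat \<Rightarrow> nat \<Rightarrow> (real \<Rightarrow> real vec) \<Rightarrow> real \<Rightarrow> real vec" where
  "vec_deriv n k X x = vec n (\<lambda>i. (deriv ^^ k) (\<lambda>y. X y $ i) x)"

definition mat_deriv :: "nat \<Rightarrow> (real \<Rightarrow> real mat) \<Rightarrow> real \<Rightarrow> real mat" where
  "mat_deriv n A x = mat n n (\<lambda>(i, k). deriv (\<lambda>y. A y $$ (i, k)) x)"

definition commutator :: "'a::ring mat \<Rightarrow> 'a mat \<Rightarrow> 'a mat" where
  "commutator A B = A * B - B * A"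


subsection \<open>Central affine curves\<close>

definition frame_cols :: "nat \<Rightarrow> (real \<Rightarrow> real vec) \<Rightarrow> real \<Rightarrow> real vec list" where
  "frame_cols n \<gamma> x = map (\<lambda>k. vec_deriv n k \<gamma> x) [0..<n]"

definition frame :: "nat \<Rightarrow> (real \<Rightarrow> real vec) \<Rightarrow> real \<Rightarrow> real mat" where
  "frame n \<gamma> x = mat_of_cols n (frame_cols n \<gamma> x)"

definition central_affine_curves :: "nat \<Rightarrow> (real \<Rightarrow> real vec) set" where
  "central_affine_curves n =
     {\<gamma>. smooth_vec n \<gamma> \<and> (\<forall>x. \<gamma> x \<noteq> 0\<^sub>v n) \<and> (\<forall>x. det (frame n \<gamma> x) = 1)}"

definition V_space :: "nat \<Rightarrow> real mat set" where
  "V_space n = {A \<in> carrier_mat n n.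
     \<forall>i<n. \<forall>k<n. A $$ (i, k) \<noteq> 0 \<longrightarrow> i < n - 1 \<and> k = n - 1}"

text \<open>The matrix \<open>u = \<Sum>\<^sub>i u\<^sub>i e\<^sub>i\<^sub>n\<close> whose entries are the coefficients of the \<open>n\<close>-th derivative
  of the curve with respect to its first \<open>n - 1\<close> frame vectors. They exist and are unique for a
  curve in \<open>central_affine_curves n\<close>.\<close>

definition central_affine_curvature ::
  "nat \<Rightarrow> (real \<Rightarrow> real vec) \<Rightarrow> real \<Rightarrow> real mat" where
  "central_affine_curvature n \<gamma> x = (THE u. u \<in> V_space n \<and>
     (\<forall>r<n. vec_deriv n n \<gamma> x $ r =
        (\<Sum>i<n - 1. u $$ (i, n - 1) * vec_deriv n i \<gamma> x $ r)))"

definition tangent_at :: "nat \<Rightarrow> (real \<Rightarrow> real vec) \<Rightarrow> (real \<Rightarrow> real vec) \<Rightarrow> bool" where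
  "tangent_at n \<gamma> X \<longleftrightarrow> smooth_vec n X \<and>
     (\<forall>x. (\<Sum>i<n. det (mat_of_cols n ((frame_cols n \<gamma> x)[i := vec_deriv n i X x]))) = 0)"

text \<open>The evolution equation \<open>\<gamma>\<^sub>t = \<xi>(\<gamma>)\<close> is a flow equation on the space of central affine
  curves if \<open>\<xi>\<close> is a vector field on that space, i.e. assigns to every curve of the space
  a tangent vector at this curve.\<close>

definition flow_equation ::
  "nat \<Rightarrow> ((real \<Rightarrow> real vec) \<Rightarrow> (real \<Rightarrow> real vec)) \<Rightarrow> bool" where
  "flow_equation n \<xi> \<longleftrightarrow> (\<forall>\<gamma> \<in> central_affine_curves n. tangent_at n \<gamma> (\<xi> \<gamma>))"


subsection \<open>The formal series \<open>Y(u,\<lambda>)\<close>\<close>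

text \<open>Series in \<open>\<lambda>\<close> with finitely many positive powers are formal Laurent series in the
  variable \<open>\<lambda>\<^sup>-\<^sup>1\<close>. Hence \<open>\<lambda>\<close> is the inverse of that variable, and the coefficient of \<open>\<lambda>\<^sup>i\<close>
  is the one at position \<open>-i\<close>.\<close>

definition lam :: "real fls" where
  "lam = fls_X_inv"

definition lam_coeff :: "int \<Rightarrow> real fls mat \<Rightarrow> real mat" where
  "lam_coeff i A = map_mat (\<lambda>f. fls_nth f (- i)) A"

definition elem_mat :: "nat \<Rightarrow> nat \<Rightarrow> nat \<Rightarrow> 'a::zero_neq_one mat" where
  "elem_mat n i k = mat n n (\<lambda>p. if p = (i, k) then 1 else 0)"

definition b_mat :: "nat \<Rightarrow> 'a::zero_neq_one mat" where
  "b_mat n = mat n n (\<lambda>(i, k). if i = Suc k then 1 else 0)"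

definition J_mat :: "nat \<Rightarrow> real fls mat" where
  "J_mat n = lam \<cdot>\<^sub>m elem_mat n 0 (n - 1) + b_mat n"

text \<open>That the entries of \<open>Y\<close> and \<open>\<zeta>\<close> are differential polynomials in \<open>u\<close> is a consequence
  and not part of the two specifications below: both objects are already unique among those
  with smooth coefficients.\<close>

definition is_Y_series :: "nat \<Rightarrow> (real \<Rightarrow> real mat) \<Rightarrow> (real \<Rightarrow> real fls mat) \<Rightarrow> bool" where
  "is_Y_series n u Y \<longleftrightarrow>
     (\<forall>x. Y x \<in> carrier_mat n n) \<and>
     (\<forall>i x. i > 1 \<longrightarrow> lam_coeff i (Y x) = 0\<^sub>m n n) \<and>
     (\<forall>x. lam_coeff 1 (Y x) = elem_mat n 0 (n - 1)) \<and>
     (\<forall>i. smooth_mat n (\<lambda>x. lam_coeff i (Y x))) \<and>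
     (\<forall>i x. (\<Sum>k<n. lam_coeff i (Y x) $$ (k, k)) = 0) \<and>
     (\<forall>i x. mat_deriv n (\<lambda>y. lam_coeff i (Y y)) x
        + lam_coeff i (commutator (J_mat n + map_mat fls_const (u x)) (Y x)) = 0\<^sub>m n n) \<and>
     (\<forall>x. Y x ^\<^sub>m n = lam \<cdot>\<^sub>m 1\<^sub>m n)"

definition Y_series :: "nat \<Rightarrow> (real \<Rightarrow> real mat) \<Rightarrow> real \<Rightarrow> real fls mat" where
  "Y_series n u = (THE Y. is_Y_series n u Y)"

definition Y_coeff :: "nat \<Rightarrow> nat \<Rightarrow> int \<Rightarrow> (real \<Rightarrow> real mat) \<Rightarrow> real \<Rightarrow> real mat" where
  "Y_coeff n j i u x = lam_coeff i (Y_series n u x ^\<^sub>m j)"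

definition strictly_upper :: "nat \<Rightarrow> real mat \<Rightarrow> bool" where
  "strictly_upper n A \<longleftrightarrow> A \<in> carrier_mat n n \<and> (\<forall>i<n. \<forall>k\<le>i. A $$ (i, k) = 0)"

definition is_zeta ::
  "nat \<Rightarrow> nat \<Rightarrow> (real \<Rightarrow> real mat) \<Rightarrow> (real \<Rightarrow> real mat) \<Rightarrow> bool" where
  "is_zeta n j u \<zeta> \<longleftrightarrow>
     smooth_mat n \<zeta> \<and> (\<forall>x. strictly_upper n (\<zeta> x)) \<and>
     (\<forall>x. mat_deriv n (\<lambda>y. Y_coeff n j 0 u y - \<zeta> y) x
        + commutator (b_mat n + u x) (Y_coeff n j 0 u x - \<zeta> x) \<in> V_space n)"

definition zeta :: "nat \<Rightarrow> nat \<Rightarrow> (real \<Rightarrow> real mat) \<Rightarrow> real \<Rightarrow> real mat" where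
  "zeta n j u = (THE \<zeta>. is_zeta n j u \<zeta>)"

definition Z0 :: "nat \<Rightarrow> nat \<Rightarrow> (real \<Rightarrow> real mat) \<Rightarrow> real \<Rightarrow> real mat" where
  "Z0 n j u x = Y_coeff n j 0 u x - zeta n j u x"

definition curve_flow_field ::
  "nat \<Rightarrow> nat \<Rightarrow> (real \<Rightarrow> real vec) \<Rightarrow> (real \<Rightarrow> real vec)" where
  "curve_flow_field n j \<gamma> = (\<lambda>x.
     frame n \<gamma> x *\<^sub>v (Z0 n j (central_affine_curvature n \<gamma>) x *\<^sub>v unit_vec n 0))"

end

theory Submission
  imports "HOL-Analysis.Interval_Integral" Defs
begin

text \<open>
  Over power series in \<open>X = \<lambda>\<^sup>-\<^sup>1\<close> put \<open>K = X J\<close>. Since \<open>x\<close> ranges over the whole line, a dressing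
  matrix \<open>M\<close> with \<open>M\<^sub>x + (J + u) M = M J\<close> can be found degree by degree (\<open>\<lambda>\<close> has degree \<open>n\<close>,
  \<open>e\<^sub>i\<^sub>k\<close> has degree \<open>i - k\<close>): the equation determines each homogeneous part of \<open>M\<close> up to a scalar
  function, and solvability in the next degree fixes that scalar up to integration.
  Then \<open>Y = M J M\<^sup>-\<^sup>1\<close>. Conjugating a second solution by \<open>M\<close> gives a solution for \<open>u = 0\<close>;
  its homogeneous parts are constant multiples of powers of \<open>J\<close>, so it commutes with \<open>J\<close>, and
  \<open>Y\<^sup>n = \<lambda>\<close> forces it to be \<open>J\<close>. As \<open>tr (Y\<^sup>j) = tr (J\<^sup>j)\<close>, the trace of \<open>Y\<^sup>j\<close> vanishes.

  A matrix \<open>Z\<close> with \<open>[\<partial>\<^sub>x + b + u, Z]\<close> in \<open>V\<^sub>n\<close> is determined by its first column, because each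
  column of \<open>Z\<close> is obtained from the previous one by applying \<open>\<partial>\<^sub>x + b + u\<close>. Hence the columns of
  \<open>g Z\<close> are the successive derivatives of \<open>\<xi> = g Z e\<^sub>1\<close>, and by Cramer's rule the tangency
  condition reads \<open>tr Z = 0\<close>.
\<close>


text \<open>\<open>Y_series\<close>, \<open>zeta\<close> and \<open>central_affine_curvature\<close>
  are definite descriptions, so nothing is known of them before existence and uniqueness are proved;
  most of the work goes there. Multiplication by X brings J and Y into power series, an integral
  domain where determinants and adjugates serve for inversion and cancellation. Since Y_x carries
  one factor \<lambda> and [J + u, Y] carries two, a factor X stays in front of the derivative. The
  grading by degree and the expansion in \<lambda> do not match: the constant coefficient of M is in
  general not the identity but only upper unitriangular. This still makes \<open>det M\<close> a
  unit, and conjugation by M still preserves e_1n, the leading coefficient of Y. The vanishing trace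
  serves twice: for the tangency, and before that for the existence of \<zeta>, because V_n excludes
  the entry (n,n). That n does not divide j enters through the diagonal of J^j.\<close>

unbundle no fps_syntax
no_notation Finite_Cartesian_Product.vec_nth (infixl \<open>$\<close> 90)

section \<open>Smooth functions\<close>

lemma smooth_fun_iff:
  "smooth_fun f \<longleftrightarrow> (\<forall>x. f field_differentiable at x) \<and> smooth_fun (deriv f)"
proof
  assume f: "smooth_fun f"
  have "(deriv ^^ k) (deriv f) field_differentiable at x" for k x
    using f[unfolded smooth_fun_def, rule_format, of "Suc k" x] by (simp only: funpow_Suc_right o_apply)
  moreover have "f field_differentiable at x" for x
    using f[unfolded smooth_fun_def, rule_format, of 0 x] by simp
  ultimately show "(\<forall>x. f field_differentiable at x) \<and> smooth_fun (deriv f)"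
    by (simp add: smooth_fun_def)
next
  assume f: "(\<forall>x. f field_differentiable at x) \<and> smooth_fun (deriv f)"
  have "(deriv ^^ k) f field_differentiable at x" for k x
  proof (cases k)
    case (Suc l)
    then show ?thesis
      using f unfolding smooth_fun_def by (simp only: funpow_Suc_right o_apply)
  qed (use f in simp)
  then show "smooth_fun f" by (simp add: smooth_fun_def)
qed

lemma smooth_fun_deriv: "smooth_fun f \<Longrightarrow> smooth_fun (deriv f)"
  using smooth_fun_iff by blast

lemma smooth_fun_differentiable: "smooth_fun f \<Longrightarrow> f field_differentiable at x"
  using smooth_fun_iff by blast

lemma smooth_fun_has_deriv: "smooth_fun f \<Longrightarrow> (f has_field_derivative deriv f x) (at x)"
  using smooth_fun_differentiable field_differentiable_derivI by blast

lemma smooth_fun_coinduct: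
  assumes "S f"
    and "\<And>f x. S f \<Longrightarrow> f field_differentiable at x"
    and "\<And>f. S f \<Longrightarrow> S (deriv f)"
  shows "smooth_fun f"
proof -
  have "S ((deriv ^^ k) f)" for k
    by (induction k) (auto simp: assms)
  then show ?thesis using assms(2) by (auto simp: smooth_fun_def)
qed

text \<open>The derivative of a product of smooth functions is a sum of products, so the class to
  which \<open>smooth_fun_coinduct\<close> is applied has to contain all sums and products at
  once.\<close>

inductive smooth_alg :: "(real \<Rightarrow> real) \<Rightarrow> bool" where
  base: "smooth_fun f \<Longrightarrow> smooth_alg f"
| add: "smooth_alg f \<Longrightarrow> smooth_alg g \<Longrightarrow> smooth_alg (\<lambda>x. f x + g x)"
| mult: "smooth_alg f \<Longrightarrow> smooth_alg g \<Longrightarrow> smooth_alg (\<lambda>x. f x * g x)"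

lemma smooth_alg_differentiable: "smooth_alg f \<Longrightarrow> f field_differentiable at x"
  by (induction rule: smooth_alg.induct)
     (auto intro: smooth_fun_differentiable field_differentiable_add field_differentiable_mult)

lemma smooth_alg_deriv: "smooth_alg f \<Longrightarrow> smooth_alg (deriv f)"
proof (induction rule: smooth_alg.induct)
  case (base f)
  then show ?case by (intro smooth_alg.base smooth_fun_deriv)
next
  case (add f g)
  have "deriv (\<lambda>x. f x + g x) = (\<lambda>x. deriv f x + deriv g x)"
    by (rule ext) (simp add: add smooth_alg_differentiable)
  then show ?case using add by (simp add: smooth_alg.add)
next
  case (mult f g)
  have "deriv (\<lambda>x. f x * g x) = (\<lambda>x. f x * deriv g x + deriv f x * g x)"
    by (rule ext) (simp add: mult smooth_alg_differentiable)
  then show ?case using mult by (simp add: smooth_alg.add smooth_alg.mult)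
qed

lemma smooth_alg_smooth_fun: "smooth_alg f \<Longrightarrow> smooth_fun f"
  by (rule smooth_fun_coinduct[of smooth_alg]) (auto intro: smooth_alg_differentiable smooth_alg_deriv)

lemma smooth_fun_add [intro]: "smooth_fun f \<Longrightarrow> smooth_fun g \<Longrightarrow> smooth_fun (\<lambda>x. f x + g x)"
  by (rule smooth_alg_smooth_fun, rule smooth_alg.add; rule smooth_alg.base)

lemma smooth_fun_mult [intro]: "smooth_fun f \<Longrightarrow> smooth_fun g \<Longrightarrow> smooth_fun (\<lambda>x. f x * g x)"
  by (rule smooth_alg_smooth_fun, rule smooth_alg.mult; rule smooth_alg.base)

lemma smooth_fun_const [simp, intro]: "smooth_fun (\<lambda>x. c)"
proof (rule smooth_fun_coinduct[of "\<lambda>f. \<exists>c. f = (\<lambda>x. c)"])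
  show "\<exists>c. deriv f = (\<lambda>x. c)" if "\<exists>c. f = (\<lambda>x. c)" for f :: "real \<Rightarrow> real"
    using that by auto
qed auto

lemma smooth_fun_minus [intro]: "smooth_fun f \<Longrightarrow> smooth_fun (\<lambda>x. - f x)"
  using smooth_fun_mult[of "\<lambda>x. -1" f] by simp

lemma smooth_fun_diff [intro]: "smooth_fun f \<Longrightarrow> smooth_fun g \<Longrightarrow> smooth_fun (\<lambda>x. f x - g x)"
  using smooth_fun_add[of f "\<lambda>x. - g x"] smooth_fun_minus by simp

lemma smooth_fun_sum [intro]:
  "(\<And>i. i \<in> I \<Longrightarrow> smooth_fun (f i)) \<Longrightarrow> smooth_fun (\<lambda>x. \<Sum>i\<in>I. f i x)"
  by (induction I rule: infinite_finite_induct) auto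

lemma smooth_fun_prod [intro]:
  "(\<And>i. i \<in> I \<Longrightarrow> smooth_fun (f i)) \<Longrightarrow> smooth_fun (\<lambda>x. \<Prod>i\<in>I. f i x)"
  by (induction I rule: infinite_finite_induct) auto

text \<open>The antiderivative lives on the whole line, which keeps the integrations in the dressing
  recursion global.\<close>

lemma smooth_fun_antiderivative:
  assumes "smooth_fun f"
  obtains F where "smooth_fun F" "deriv F = f"
proof -
  have "isCont f x" for x
    using assms by (intro field_differentiable_imp_continuous_at smooth_fun_differentiable)
  then obtain F where F: "\<And>x. (F has_vector_derivative f x) (at x)"
    using einterval_antiderivative[of "- \<infinity>" "\<infinity>" f] by auto
  then have F': "(F has_field_derivative f x) (at x)" for x
    by (simp add: has_real_derivative_iff_has_vector_derivative)
  then have d: "deriv F = f" by (auto intro: DERIV_imp_deriv)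
  moreover have "smooth_fun F"
    by (subst smooth_fun_iff) (use F' d assms field_differentiable_def in auto)
  ultimately show ?thesis using that by blast
qed

section \<open>Families of power series\<close>

definition smooth_fps :: "(real \<Rightarrow> real fps) \<Rightarrow> bool" where
  "smooth_fps F \<longleftrightarrow> (\<forall>m. smooth_fun (\<lambda>x. fps_nth (F x) m))"

definition fps_dx :: "(real \<Rightarrow> real fps) \<Rightarrow> real \<Rightarrow> real fps" where
  "fps_dx F x = Abs_fps (\<lambda>m. deriv (\<lambda>y. fps_nth (F y) m) x)"

lemma fps_dx_nth [simp]: "fps_nth (fps_dx F x) m = deriv (\<lambda>y. fps_nth (F y) m) x"
  by (simp add: fps_dx_def)

lemma smooth_fps_const [simp, intro]: "smooth_fps (\<lambda>x. c)"
  by (simp add: smooth_fps_def)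

lemma smooth_fps_add [intro]: "smooth_fps F \<Longrightarrow> smooth_fps G \<Longrightarrow> smooth_fps (\<lambda>x. F x + G x)"
  by (auto simp: smooth_fps_def)

lemma smooth_fps_mult [intro]: "smooth_fps F \<Longrightarrow> smooth_fps G \<Longrightarrow> smooth_fps (\<lambda>x. F x * G x)"
  by (simp add: smooth_fps_def fps_mult_nth smooth_fun_sum smooth_fun_mult)

lemma smooth_fps_sum [intro]:
  "(\<And>i. i \<in> I \<Longrightarrow> smooth_fps (F i)) \<Longrightarrow> smooth_fps (\<lambda>x. \<Sum>i\<in>I. F i x)"
  by (induction I rule: infinite_finite_induct) auto

lemma smooth_fps_prod [intro]:
  "(\<And>i. i \<in> I \<Longrightarrow> smooth_fps (F i)) \<Longrightarrow> smooth_fps (\<lambda>x. \<Prod>i\<in>I. F i x)"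
  by (induction I rule: infinite_finite_induct) auto

text \<open>With constant coefficient 1 the recursion for the coefficients of the inverse involves
  no division, so each of them is a polynomial in the coefficients of \<open>F\<close>.\<close>

lemma smooth_fps_inverse:
  assumes F: "smooth_fps F" and F0: "\<And>x. fps_nth (F x) 0 = 1"
  shows "smooth_fps (\<lambda>x. inverse (F x))"
proof -
  have "smooth_fun (\<lambda>x. fps_nth (inverse (F x)) m)" for m
  proof (induction m rule: less_induct)
    case (less m)
    show ?case
    proof (cases m)
      case 0
      then show ?thesis by (simp add: F0)
    next
      case (Suc l)
      have "(\<lambda>x. fps_nth (inverse (F x)) m) =
          (\<lambda>x. - (\<Sum>i=1..m. fps_nth (F x) i * fps_nth (inverse (F x)) (m - i)))"
        by (simp add: fps_inverse_def Suc F0)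
      moreover have "smooth_fun \<dots>"
        using less F by (intro smooth_fun_minus smooth_fun_sum smooth_fun_mult)
          (auto simp: smooth_fps_def)
      ultimately show ?thesis by simp
    qed
  qed
  then show ?thesis by (simp add: smooth_fps_def)
qed

lemma fps_dx_const [simp]: "fps_dx (\<lambda>x. c) x = 0"
  by (rule fps_ext) simp

lemma fps_dx_add:
  "smooth_fps F \<Longrightarrow> smooth_fps G \<Longrightarrow> fps_dx (\<lambda>x. F x + G x) x = fps_dx F x + fps_dx G x"
  by (rule fps_ext) (simp add: smooth_fps_def smooth_fun_differentiable)

lemma fps_dx_mult:
  assumes "smooth_fps F" "smooth_fps G"
  shows "fps_dx (\<lambda>x. F x * G x) x = fps_dx F x * G x + F x * fps_dx G x"
proof (rule fps_ext)
  fix m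
  have d: "(\<lambda>x. fps_nth (F x) i) field_differentiable at x"
    "(\<lambda>x. fps_nth (G x) i) field_differentiable at x" for i
    using assms by (simp_all add: smooth_fps_def smooth_fun_differentiable)
  have "fps_nth (fps_dx (\<lambda>x. F x * G x) x) m
      = deriv (\<lambda>y. \<Sum>i=0..m. fps_nth (F y) i * fps_nth (G y) (m - i)) x"
    by (simp add: fps_mult_nth)
  also have "\<dots> = (\<Sum>i=0..m. deriv (\<lambda>y. fps_nth (F y) i * fps_nth (G y) (m - i)) x)"
    by (intro deriv_sum field_differentiable_mult d)
  also have "\<dots> = fps_nth (fps_dx F x * G x + F x * fps_dx G x) m"
    by (simp add: fps_mult_nth d sum.distrib)
  finally show "fps_nth (fps_dx (\<lambda>x. F x * G x) x) m
      = fps_nth (fps_dx F x * G x + F x * fps_dx G x) m" .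
qed

lemma fps_dx_sum:
  "(\<And>i. i \<in> I \<Longrightarrow> smooth_fps (F i)) \<Longrightarrow>
    fps_dx (\<lambda>x. \<Sum>i\<in>I. F i x) x = (\<Sum>i\<in>I. fps_dx (F i) x)"
  by (induction I rule: infinite_finite_induct) (auto simp: fps_dx_add smooth_fps_sum)

section \<open>Matrices of power series depending on x\<close>

definition smooth_fps_mat :: "nat \<Rightarrow> (real \<Rightarrow> real fps mat) \<Rightarrow> bool" where
  "smooth_fps_mat n A \<longleftrightarrow>
     (\<forall>x. A x \<in> carrier_mat n n) \<and> (\<forall>i<n. \<forall>k<n. smooth_fps (\<lambda>x. A x $$ (i, k)))"

definition fps_mat_dx :: "nat \<Rightarrow> (real \<Rightarrow> real fps mat) \<Rightarrow> real \<Rightarrow> real fps mat" where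
  "fps_mat_dx n A x = mat n n (\<lambda>(i, k). fps_dx (\<lambda>y. A y $$ (i, k)) x)"

lemma fps_mat_dx_carrier [simp]: "fps_mat_dx n A x \<in> carrier_mat n n"
  by (simp add: fps_mat_dx_def)

lemma smooth_fps_matD:
  assumes "smooth_fps_mat n A"
  shows "A x \<in> carrier_mat n n" "i < n \<Longrightarrow> k < n \<Longrightarrow> smooth_fps (\<lambda>x. A x $$ (i, k))"
  using assms by (auto simp: smooth_fps_mat_def)

lemma smooth_fps_mat_const: "A \<in> carrier_mat n n \<Longrightarrow> smooth_fps_mat n (\<lambda>x. A)"
  by (simp add: smooth_fps_mat_def)

lemma fps_mat_dx_const [simp]: "fps_mat_dx n (\<lambda>x. A) x = 0\<^sub>m n n"
  by (rule eq_matI) (auto simp: fps_mat_dx_def)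

lemma mult_mat_index:
  assumes "A \<in> carrier_mat n n" "B \<in> carrier_mat n n" "i < n" "k < n"
  shows "(A * B) $$ (i, k) = (\<Sum>l<n. A $$ (i, l) * B $$ (l, k))"
  using assms by (auto simp: scalar_prod_def lessThan_atLeast0 intro!: sum.cong)

lemma smooth_fps_mat_mult:
  assumes A: "smooth_fps_mat n A" and B: "smooth_fps_mat n B"
  shows "smooth_fps_mat n (\<lambda>x. A x * B x)"
proof -
  note c = smooth_fps_matD(1)[OF A] smooth_fps_matD(1)[OF B]
  have "smooth_fps (\<lambda>x. (A x * B x) $$ (i, k))" if "i < n" "k < n" for i k
    using that smooth_fps_matD(2)[OF A] smooth_fps_matD(2)[OF B]
    by (auto simp: mult_mat_index[OF c] intro!: smooth_fps_sum smooth_fps_mult)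
  then show ?thesis using mult_carrier_mat[OF c] by (simp add: smooth_fps_mat_def)
qed

lemma fps_mat_dx_mult:
  assumes A: "smooth_fps_mat n A" and B: "smooth_fps_mat n B"
  shows "fps_mat_dx n (\<lambda>x. A x * B x) x = fps_mat_dx n A x * B x + A x * fps_mat_dx n B x"
proof (rule eq_matI)
  note c = smooth_fps_matD(1)[OF A] smooth_fps_matD(1)[OF B]
  note s = smooth_fps_matD(2)[OF A] smooth_fps_matD(2)[OF B]
  fix i k
  assume ik: "i < dim_row (fps_mat_dx n A x * B x + A x * fps_mat_dx n B x)"
    "k < dim_col (fps_mat_dx n A x * B x + A x * fps_mat_dx n B x)"
  then have ik: "i < n" "k < n" using c(1)[of x] c(2)[of x] by (auto simp: fps_mat_dx_def)
  have "fps_mat_dx n (\<lambda>x. A x * B x) x $$ (i, k)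
      = fps_dx (\<lambda>y. \<Sum>l<n. A y $$ (i, l) * B y $$ (l, k)) x"
    using ik by (simp add: fps_mat_dx_def mult_mat_index[OF c])
  also have "\<dots> = (\<Sum>l<n. fps_dx (\<lambda>y. A y $$ (i, l)) x * B x $$ (l, k)
      + A x $$ (i, l) * fps_dx (\<lambda>y. B y $$ (l, k)) x)"
    using ik by (subst fps_dx_sum) (auto intro!: smooth_fps_mult s sum.cong fps_dx_mult)
  also have "\<dots> = (fps_mat_dx n A x * B x) $$ (i, k) + (A x * fps_mat_dx n B x) $$ (i, k)"
    using ik mult_mat_index[OF fps_mat_dx_carrier c(2) ik, of A x x]
      mult_mat_index[OF c(1) fps_mat_dx_carrier ik, of x B x]
    by (simp add: sum.distrib fps_mat_dx_def)
  also have "\<dots> = (fps_mat_dx n A x * B x + A x * fps_mat_dx n B x) $$ (i, k)"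
    using ik c(1)[of x] c(2)[of x] by (simp add: fps_mat_dx_def)
  finally show "fps_mat_dx n (\<lambda>x. A x * B x) x $$ (i, k)
      = (fps_mat_dx n A x * B x + A x * fps_mat_dx n B x) $$ (i, k)" .
qed (use smooth_fps_matD(1)[OF A, of x] smooth_fps_matD(1)[OF B, of x] in \<open>auto simp: fps_mat_dx_def\<close>)

lemma smooth_fps_det:
  assumes "\<And>x. A x \<in> carrier_mat n n" "\<And>i k. i < n \<Longrightarrow> k < n \<Longrightarrow> smooth_fps (\<lambda>x. A x $$ (i, k))"
  shows "smooth_fps (\<lambda>x. det (A x))"
proof -
  have "smooth_fps (\<lambda>x. \<Prod>i = 0..<n. A x $$ (i, p i))" if "p permutes {0..<n}" for p
    using that assms(2) by (intro smooth_fps_prod) (auto dest: permutes_in_image)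
  then show ?thesis
    unfolding det_def'[OF assms(1)]
    by (intro smooth_fps_sum smooth_fps_mult smooth_fps_const) auto
qed

lemma smooth_fps_mat_adj:
  assumes A: "smooth_fps_mat n A"
  shows "smooth_fps_mat n (\<lambda>x. adj_mat (A x))"
proof -
  note c = smooth_fps_matD(1)[OF A]
  have d: "dim_row (A x) = n" "dim_col (A x) = n" for x using c[of x] by auto
  have "smooth_fps (\<lambda>x. det (mat_delete (A x) i k))" if ik: "i < n" "k < n" for i k
  proof (rule smooth_fps_det)
    show "mat_delete (A x) i k \<in> carrier_mat (n - 1) (n - 1)" for x
      using c by (simp add: mat_delete_def d)
    fix i' k' assume "i' < n - 1" "k' < n - 1"
    then show "smooth_fps (\<lambda>x. mat_delete (A x) i k $$ (i', k'))"
      using smooth_fps_matD(2)[OF A] by (auto simp: mat_delete_def d)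
  qed
  then have "smooth_fps (\<lambda>x. adj_mat (A x) $$ (i, k))" if "i < n" "k < n" for i k
    using that unfolding adj_mat_def d cofactor_def by (auto simp: smooth_fps_mult)
  then show ?thesis using adj_mat(1)[OF c] by (simp add: smooth_fps_mat_def)
qed


section \<open>The dressing matrix\<close>

text \<open>The dressing recursion looks back up to m steps, hence below index 0 at its start, where
  all functions are zero.\<close>

definition nonneg_ext :: "(nat \<Rightarrow> nat \<Rightarrow> real \<Rightarrow> real) \<Rightarrow> int \<Rightarrow> nat \<Rightarrow> real \<Rightarrow> real" where
  "nonneg_ext h t = (if t < 0 then (\<lambda>_ _. 0) else h (nat t))"

text \<open>\<open>q t i\<close> is the coefficient in row \<open>i\<close> of the part of degree \<open>-t\<close> of the dressing matrix. The
  second-to-last equation determines \<open>q (t + 1)\<close> up to a function independent of the row, and the last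
  one requires that the derivatives of \<open>q t\<close>, summed over the rows, cancel the terms with \<open>u\<close>; the
  free function in \<open>q t\<close> is chosen by integration to achieve this.\<close>

lemma dressing_coefficients:
  fixes U :: "nat \<Rightarrow> real \<Rightarrow> real"
  assumes U: "\<And>i. i \<le> m \<Longrightarrow> smooth_fun (U i)" and Um: "\<And>x. U m x = 0"
  shows "\<exists>q :: int \<Rightarrow> nat \<Rightarrow> real \<Rightarrow> real.
    (\<forall>t i. i \<le> m \<longrightarrow> smooth_fun (q t i)) \<and>
    (\<forall>t i x. t < 0 \<longrightarrow> q t i x = 0) \<and>
    (\<forall>i x. i \<le> m \<longrightarrow> q 0 i x = 1) \<and>
    (\<forall>t i x. i < m \<longrightarrow> q (t + 1) (Suc i) x
        = q (t + 1) i x + deriv (q t (Suc i)) x + U (Suc i) x * q (t + int (Suc i) - int m) m x) \<and>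
    (\<forall>t x. q (t + 1) 0 x = q (t + 1) m x + deriv (q t 0) x + U 0 x * q (t - int m) m x)"
proof -
  \<comment> \<open>\<open>r\<close> is an admissible choice of \<open>q t\<close> when
    \<open>h\<close> holds the earlier functions. The last clause, a sum over all rows, is the
    solvability condition for the next degree. All indices of \<open>h\<close> lie below t, as i <
    m; row m drops out of the last sum because \<open>U m\<close> vanishes.\<close>
  define P :: "(nat \<Rightarrow> nat \<Rightarrow> real \<Rightarrow> real) \<Rightarrow> nat \<Rightarrow> (nat \<Rightarrow> real \<Rightarrow> real) \<Rightarrow> bool" where
    "P h t r \<longleftrightarrow> (\<forall>i\<le>m. smooth_fun (r i)) \<and> (t = 0 \<longrightarrow> (\<forall>i\<le>m. r i = (\<lambda>x. 1)))
      \<and> (t > 0 \<longrightarrow> (\<forall>i<m. \<forall>x. r (Suc i) x = r i x + deriv (h (t - 1) (Suc i)) x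
            + U (Suc i) x * nonneg_ext h (int t + int i - int m) m x))
      \<and> (\<forall>x. (\<Sum>i\<le>m. deriv (r i) x)
            + (\<Sum>i<m. U i x * nonneg_ext h (int t + int i - int m) m x) = 0)" for h t r
  have "\<exists>f. \<forall>t. P f t (f t)"
  proof (rule dependent_wellorder_choice)
    fix r and f g :: "nat \<Rightarrow> nat \<Rightarrow> real \<Rightarrow> real" and t :: nat
    assume eq: "\<And>y. y < t \<Longrightarrow> f y = g y"
    have e: "nonneg_ext f (int t + int i - int m) = nonneg_ext g (int t + int i - int m)"
      if "i < m" for i
      using that eq by (auto simp: nonneg_ext_def)
    have e': "0 < t \<Longrightarrow> f (t - 1) = g (t - 1)" using eq by simp
    show "P f t r = P g t r"
      unfolding P_def using e e' by (auto simp: e)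
  next
    fix t :: nat and h :: "nat \<Rightarrow> nat \<Rightarrow> real \<Rightarrow> real"
    assume IH: "\<And>y. y < t \<Longrightarrow> P h y (h y)"
    have sm: "smooth_fun (h y i)" if "y < t" "i \<le> m" for y i
      using IH[OF that(1)] that(2) unfolding P_def by blast
    have sme: "smooth_fun (nonneg_ext h (int t + int i - int m) m)" if "i < m" for i
      using that sm by (auto simp: nonneg_ext_def)
    show "\<exists>r. P h t r"
    proof (cases "t = 0")
      case True
      then have "P h t (\<lambda>i x. 1)"
        by (auto simp: P_def nonneg_ext_def)
      then show ?thesis by blast
    next
      case False
      \<comment> \<open>\<open>w i\<close> is the prescribed difference between rows
        \<open>i + 1\<close> and \<open>i\<close>, and \<open>s\<close> are its partial sums; what
        remains free is row 0, the function \<open>a\<close> below.\<close>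
      define w where "w i x = deriv (h (t - 1) (Suc i)) x
        + U (Suc i) x * nonneg_ext h (int t + int i - int m) m x" for i x
      define s where "s i x = (\<Sum>l<i. w l x)" for i x
      have w: "smooth_fun (w i)" if "i < m" for i
        unfolding w_def using that False
        by (intro smooth_fun_add smooth_fun_mult smooth_fun_deriv sm U sme) auto
      have s: "smooth_fun (s i)" if "i \<le> m" for i
        unfolding s_def using that by (intro smooth_fun_sum w) auto
      \<comment> \<open>Inserting \<open>r i = a + s i\<close> into the solvability condition
        produces the derivative of \<open>a\<close> once for each of the m + 1 rows, hence the
        factor 1 / (m + 1).\<close>
      define v where "v x = - (1 / real (Suc m)) * ((\<Sum>i\<le>m. deriv (s i) x)
        + (\<Sum>i<m. U i x * nonneg_ext h (int t + int i - int m) m x))" for x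
      have "smooth_fun v"
        unfolding v_def
        by (intro smooth_fun_mult smooth_fun_add smooth_fun_sum smooth_fun_const
            smooth_fun_deriv s U sme) auto
      then obtain a where a: "smooth_fun a" "deriv a = v"
        by (rule smooth_fun_antiderivative)
      define r where "r i x = a x + s i x" for i x
      have d: "deriv (r i) x = v x + deriv (s i) x" if "i \<le> m" for i x
        unfolding r_def using a s[OF that] by (simp add: smooth_fun_differentiable)
      have "(\<Sum>i\<le>m. deriv (r i) x) = real (Suc m) * v x + (\<Sum>i\<le>m. deriv (s i) x)" for x
        by (simp add: d sum.distrib)
      moreover have "real (Suc m) * v x = - ((\<Sum>i\<le>m. deriv (s i) x)
        + (\<Sum>i<m. U i x * nonneg_ext h (int t + int i - int m) m x))" for x
        unfolding v_def by (simp del: of_nat_Suc)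
      ultimately have "(\<Sum>i\<le>m. deriv (r i) x)
          + (\<Sum>i<m. U i x * nonneg_ext h (int t + int i - int m) m x) = 0" for x
        by simp
      moreover have "smooth_fun (r i)" if "i \<le> m" for i
        unfolding r_def using a s[OF that] by (intro smooth_fun_add)
      moreover have "r (Suc i) x = r i x + deriv (h (t - 1) (Suc i)) x
            + U (Suc i) x * nonneg_ext h (int t + int i - int m) m x" for i x
        by (simp add: r_def s_def w_def)
      ultimately have "P h t r" using False unfolding P_def by blast
      then show ?thesis by blast
    qed
  qed
  then obtain f where f: "\<And>t. P f t (f t)" by blast
  define q where "q = nonneg_ext f"
  have neg: "q t i x = 0" if "t < 0" for t i x
    using that by (simp add: q_def nonneg_ext_def)
  have one: "q 0 i x = 1" if "i \<le> m" for i x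
    using f[of 0] that by (simp add: q_def nonneg_ext_def P_def)
  have dneg: "deriv (q t i) x = 0" if "t < 0" for t i x
    using that by (simp add: q_def nonneg_ext_def)
  have smq: "smooth_fun (q t i)" if "i \<le> m" for t i
    using f[of "nat t"] that by (auto simp: q_def nonneg_ext_def P_def)
  have step: "q (t + 1) (Suc i) x
      = q (t + 1) i x + deriv (q t (Suc i)) x + U (Suc i) x * q (t + int (Suc i) - int m) m x"
    if "i < m" for t i x
  \<comment> \<open>Below 0 only t = -1 is not trivial: there the equation compares the constants
    \<open>q 0 i = 1\<close>.\<close>
  proof (cases "t < 0")
    case True
    then show ?thesis using that by (cases "t = -1") (simp_all add: neg dneg one)
  next
    case False
    define k where "k = nat t"
    have k: "t = int k" using False by (simp add: k_def)
    have "q (int (Suc k)) = f (Suc k)" "q (int k) = f k"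
      by (simp_all add: q_def nonneg_ext_def del: of_nat_Suc)
    with f[of "Suc k"] that show ?thesis
      unfolding P_def k q_def[symmetric] by (simp add: algebra_simps)
  qed
  have bal: "(\<Sum>i\<le>m. deriv (q (int k) i) x) + (\<Sum>i<m. U i x * q (int k + int i - int m) m x) = 0"
    for k x
    using f[of k] unfolding P_def q_def[symmetric] by (simp add: q_def nonneg_ext_def)
  have "q (t + 1) 0 x = q (t + 1) m x + deriv (q t 0) x + U 0 x * q (t - int m) m x" for t x
  proof (cases "t < 0")
    case True
    then show ?thesis by (cases "t = -1") (simp_all add: neg dneg one)
  next
    case False
    then obtain k where k: "t = int k" by (metis nonneg_int_cases not_less)
    \<comment> \<open>The m row equations telescope to the difference of the last and the first row;
      \<open>bal\<close> then closes the cycle.\<close>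
    have "q (t + 1) m x - q (t + 1) 0 x = (\<Sum>i<m. q (t + 1) (Suc i) x - q (t + 1) i x)"
      by (rule sum_lessThan_telescope[symmetric])
    also have "\<dots> = (\<Sum>i<m. deriv (q t (Suc i)) x) + (\<Sum>i<m. U (Suc i) x * q (t + int (Suc i) - int m) m x)"
      unfolding sum.distrib[symmetric]
    proof (rule sum.cong)
      fix i assume "i \<in> {..<m}"
      then show "q (t + 1) (Suc i) x - q (t + 1) i x
          = deriv (q t (Suc i)) x + U (Suc i) x * q (t + int (Suc i) - int m) m x"
        using step[of i t x] by simp
    qed simp
    finally have 1: "q (t + 1) m x - q (t + 1) 0 x = \<dots>" .
    have 2: "(\<Sum>i\<le>m. deriv (q t i) x) = deriv (q t 0) x + (\<Sum>i<m. deriv (q t (Suc i)) x)"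
      by (simp only: lessThan_Suc_atMost[symmetric] sum.lessThan_Suc_shift)
    have "(\<Sum>i<m. U i x * q (t + int i - int m) m x)
        = (\<Sum>i<Suc m. U i x * q (t + int i - int m) m x)"
      by (simp add: Um)
    also have "\<dots> = U 0 x * q (t - int m) m x
        + (\<Sum>i<m. U (Suc i) x * q (t + int (Suc i) - int m) m x)"
      by (simp only: sum.lessThan_Suc_shift) simp
    finally show ?thesis using 1 2 bal[of k x] unfolding k by linarith
  qed
  with neg one smq step show ?thesis by (intro exI[of _ q]) blast
qed


text \<open>\<open>K_mat n\<close> is \<open>\<lambda>\<^sup>-\<^sup>1 J\<close> and \<open>L_mat n u\<close> is \<open>\<lambda>\<^sup>-\<^sup>1 (J + u)\<close>, with \<open>fps_X\<close> standing for \<open>\<lambda>\<^sup>-\<^sup>1\<close>.\<close>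

definition K_mat :: "nat \<Rightarrow> real fps mat" where
  "K_mat n = mat n n (\<lambda>(i, k). if i = 0 \<and> k = n - 1 then 1 else if i = Suc k then fps_X else 0)"

definition L_mat :: "nat \<Rightarrow> real mat \<Rightarrow> real fps mat" where
  "L_mat n u = K_mat n + fps_X \<cdot>\<^sub>m map_mat fps_const u"

lemma K_mat_carrier [simp]: "K_mat n \<in> carrier_mat n n"
  by (simp add: K_mat_def)

lemma L_mat_carrier [simp]: "u \<in> carrier_mat n n \<Longrightarrow> L_mat n u \<in> carrier_mat n n"
  by (simp add: L_mat_def)

lemma V_spaceD:
  assumes "u \<in> V_space n"
  shows "u \<in> carrier_mat n n" "i < n \<Longrightarrow> k < n - 1 \<Longrightarrow> u $$ (i, k) = 0"
    "n > 0 \<Longrightarrow> u $$ (n - 1, n - 1) = 0"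
proof -
  have u: "u \<in> carrier_mat n n"
    and z: "\<And>i k. i < n \<Longrightarrow> k < n \<Longrightarrow> u $$ (i, k) \<noteq> 0 \<Longrightarrow> i < n - 1 \<and> k = n - 1"
    using assms unfolding V_space_def by auto
  show "u \<in> carrier_mat n n" by (fact u)
  show "u $$ (i, k) = 0" if "i < n" "k < n - 1"
    using z[of i k] that less_le_trans[OF that(2) diff_le_self] by (cases "u $$ (i, k) = 0") auto
  show "u $$ (n - 1, n - 1) = 0" if "n > 0" using z[of "n - 1" "n - 1"] that by auto
qed

lemma K_mat_mult_index:
  assumes A: "A \<in> carrier_mat n n" and k: "k < n"
  shows "(K_mat n * A) $$ (0, k) = A $$ (n - 1, k)"
    "Suc i < n \<Longrightarrow> (K_mat n * A) $$ (Suc i, k) = fps_X * A $$ (i, k)"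
proof -
  have "(K_mat n * A) $$ (0, k) = (\<Sum>l<n. if l = n - 1 then A $$ (n - 1, k) else 0)"
    unfolding mult_mat_index[OF K_mat_carrier A order.strict_trans1[OF le0 k] k]
    using k by (intro sum.cong) (auto simp: K_mat_def)
  then show "(K_mat n * A) $$ (0, k) = A $$ (n - 1, k)" using k by simp
  assume i: "Suc i < n"
  have "(K_mat n * A) $$ (Suc i, k) = (\<Sum>l<n. if l = i then fps_X * A $$ (i, k) else 0)"
    unfolding mult_mat_index[OF K_mat_carrier A i k]
    using k i by (intro sum.cong) (auto simp: K_mat_def)
  then show "(K_mat n * A) $$ (Suc i, k) = fps_X * A $$ (i, k)" using i by simp
qed

lemma mult_K_mat_index:
  assumes A: "A \<in> carrier_mat n n" and i: "i < n"
  shows "(A * K_mat n) $$ (i, n - 1) = A $$ (i, 0)"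
    "Suc k < n \<Longrightarrow> (A * K_mat n) $$ (i, k) = fps_X * A $$ (i, Suc k)"
proof -
  have "n - 1 < n" using i by simp
  then have "(A * K_mat n) $$ (i, n - 1) = (\<Sum>l<n. A $$ (i, l) * K_mat n $$ (l, n - 1))"
    by (rule mult_mat_index[OF A K_mat_carrier i])
  also have "\<dots> = (\<Sum>l<n. if l = 0 then A $$ (i, 0) else 0)"
    using i by (intro sum.cong) (auto simp: K_mat_def)
  finally have "(A * K_mat n) $$ (i, n - 1) = \<dots>" .
  then show "(A * K_mat n) $$ (i, n - 1) = A $$ (i, 0)" using i by simp
  assume k: "Suc k < n"
  have "(A * K_mat n) $$ (i, k) = (\<Sum>l<n. if l = Suc k then fps_X * A $$ (i, Suc k) else 0)"
    unfolding mult_mat_index[OF A K_mat_carrier i Suc_lessD[OF k]]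
    using k i by (intro sum.cong) (auto simp: K_mat_def)
  then show "(A * K_mat n) $$ (i, k) = fps_X * A $$ (i, Suc k)" using k by simp
qed

text \<open>Only the last column of \<open>u\<close> is nonzero, so \<open>u\<close> sees only the
  last row of \<open>A\<close>.\<close>

lemma L_mat_mult_index:
  assumes A: "A \<in> carrier_mat n n" and u: "u \<in> V_space n" and ik: "i < n" "k < n"
  shows "(L_mat n u * A) $$ (i, k)
    = (K_mat n * A) $$ (i, k) + fps_X * (fps_const (u $$ (i, n - 1)) * A $$ (n - 1, k))"
proof -
  have uc: "u \<in> carrier_mat n n" using V_spaceD(1)[OF u] .
  then have c: "fps_X \<cdot>\<^sub>m map_mat fps_const u \<in> carrier_mat n n" by simp
  have "(fps_X \<cdot>\<^sub>m map_mat fps_const u * A) $$ (i, k)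
      = (\<Sum>l<n. if l = n - 1 then fps_X * (fps_const (u $$ (i, n - 1)) * A $$ (n - 1, k)) else 0)"
    unfolding mult_mat_index[OF c A ik]
    using ik uc V_spaceD(2)[OF u, of i] by (intro sum.cong) auto
  also have "\<dots> = fps_X * (fps_const (u $$ (i, n - 1)) * A $$ (n - 1, k))" using ik by simp
  finally show ?thesis
    unfolding L_mat_def add_mult_distrib_mat[OF K_mat_carrier c A]
    using ik A uc by simp
qed

text \<open>The part of degree -t is a diagonal matrix with entries \<open>q t i\<close> times
  J^(-t), so row and degree determine every entry. Left multiplication by J moves to the next row,
  right multiplication by J changes only the degree; this turns the matrix equation into the
  recursion for \<open>q\<close>.\<close>

lemma dressing_matrix:
  assumes n: "n > 0" and u: "smooth_mat n u" and V: "\<And>x. u x \<in> V_space n"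
  obtains M where "smooth_fps_mat n M"
    "\<And>x i k. k \<le> i \<Longrightarrow> i < n \<Longrightarrow> fps_nth (M x $$ (i, k)) 0 = (if i = k then 1 else 0)"
    "\<And>x. fps_X \<cdot>\<^sub>m fps_mat_dx n M x + L_mat n (u x) * M x = M x * K_mat n"
proof -
  define m where "m = n - 1"
  have m: "n = Suc m" using n by (simp add: m_def)
  have "smooth_fun (\<lambda>x. u x $$ (i, m))" if "i \<le> m" for i
    using u that by (simp add: smooth_mat_def m)
  moreover have "u x $$ (m, m) = 0" for x
    using V_spaceD(3)[OF V n, of x] by (simp add: m_def)
  ultimately obtain q :: "int \<Rightarrow> nat \<Rightarrow> real \<Rightarrow> real" where
    smq: "\<And>t i. i \<le> m \<Longrightarrow> smooth_fun (q t i)" and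
    neg: "\<And>t i x. t < 0 \<Longrightarrow> q t i x = 0" and
    one: "\<And>i x. i \<le> m \<Longrightarrow> q 0 i x = 1" and
    stepS: "\<And>t i x. i < m \<Longrightarrow> q (t + 1) (Suc i) x = q (t + 1) i x + deriv (q t (Suc i)) x
        + u x $$ (Suc i, m) * q (t + int (Suc i) - int m) m x" and
    step0: "\<And>t x. q (t + 1) 0 x = q (t + 1) m x + deriv (q t 0) x
        + u x $$ (0, m) * q (t - int m) m x"
    using dressing_coefficients[of m "\<lambda>i x. u x $$ (i, m)"] by blast
  \<comment> \<open>\<lambda>^(-l) e_ik has degree i - k - n l, which is -t for t = n l + k -
    i.\<close>
  define M where
    "M x = mat n n (\<lambda>(i, k). Abs_fps (\<lambda>l. q (int n * int l + int k - int i) i x))" for x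
  have Mc: "M x \<in> carrier_mat n n" for x by (simp add: M_def)
  have Mn: "fps_nth (M x $$ (i, k)) l = q (int n * int l + int k - int i) i x"
    if "i < n" "k < n" for x i k l
    using that by (simp add: M_def)
  have sM: "smooth_fps_mat n M"
    using Mc Mn smq by (simp add: smooth_fps_mat_def smooth_fps_def m)
  have dMn: "fps_nth (fps_mat_dx n M x $$ (i, k)) l = deriv (q (int n * int l + int k - int i) i) x"
    if "i < n" "k < n" for x i k l
    using that by (simp add: fps_mat_dx_def Mn)
  have "fps_X \<cdot>\<^sub>m fps_mat_dx n M x + L_mat n (u x) * M x = M x * K_mat n" for x
  proof (rule eq_matI)
    fix i k assume "i < dim_row (M x * K_mat n)" "k < dim_col (M x * K_mat n)"
    then have ik: "i < n" "k < n" by (auto simp: M_def K_mat_def)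
    have uc: "u x \<in> carrier_mat n n" using V_spaceD(1)[OF V] .
    have eq: "(fps_X \<cdot>\<^sub>m fps_mat_dx n M x + L_mat n (u x) * M x) $$ (i, k)
        = fps_X * fps_mat_dx n M x $$ (i, k) + ((K_mat n * M x) $$ (i, k)
          + fps_X * (fps_const (u x $$ (i, m)) * M x $$ (m, k)))"
      using ik uc Mc[of x] L_mat_mult_index[OF Mc V ik, of x x]
        carrier_matD[OF fps_mat_dx_carrier[of n M x]] carrier_matD[OF L_mat_carrier[OF uc]]
      by (simp add: m_def)
    have "fps_nth ((fps_X \<cdot>\<^sub>m fps_mat_dx n M x + L_mat n (u x) * M x) $$ (i, k)) l
        = fps_nth ((M x * K_mat n) $$ (i, k)) l" for l
    proof -
      have R: "fps_nth ((M x * K_mat n) $$ (i, k)) l = q (int n * (int l - 1) + int k - int i + 1) i x"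
      proof (cases "k = n - 1")
        case True
        then show ?thesis using ik mult_K_mat_index(1)[OF Mc ik(1), of x] n
          by (simp add: Mn algebra_simps of_nat_diff)
      next
        case False
        then have "Suc k < n" using ik by simp
        then show ?thesis using ik mult_K_mat_index(2)[OF Mc ik(1), of k x]
          by (cases l) (auto simp: Mn algebra_simps neg)
      qed
      \<comment> \<open>The rows are shifted cyclically. Row 0 takes row m without the factor
        \<open>fps_X\<close> that the other rows carry, and this makes the index of \<open>q\<close>
        the same in both cases. For l = 0 the factor \<open>fps_X\<close> gives 0, matching
        \<open>q\<close> at a negative index.\<close>
      have Lk: "fps_nth ((K_mat n * M x) $$ (i, k)) l =
        q (int n * (int l - 1) + int k - int i + 1) (if i = 0 then m else i - 1) x"
      proof (cases i)
        case 0
        then show ?thesis using ik K_mat_mult_index(1)[OF Mc ik(2), of x] n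
          by (simp add: Mn algebra_simps m)
      next
        case (Suc i')
        then show ?thesis using ik K_mat_mult_index(2)[OF Mc ik(2), of i' x]
          by (cases l) (auto simp: Mn algebra_simps neg)
      qed
      have D: "fps_nth (fps_X * fps_mat_dx n M x $$ (i, k)) l =
          deriv (q (int n * (int l - 1) + int k - int i) i) x"
      proof (cases l)
        case 0
        have "q (int n * (int l - 1) + int k - int i) i = (\<lambda>x. 0)"
          using 0 ik by (auto simp: neg)
        then show ?thesis using 0 by simp
      next
        case (Suc l')
        then show ?thesis using ik by (simp add: dMn)
      qed
      have E: "fps_nth (fps_X * (fps_const (u x $$ (i, m)) * M x $$ (m, k))) l
          = u x $$ (i, m) * q (int n * (int l - 1) + int k - int m) m x"
        using ik by (cases l) (auto simp: Mn neg m)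
      show ?thesis
        unfolding eq fps_add_nth R Lk D E
      proof (cases i)
        case 0
        then show "deriv (q (int n * (int l - 1) + int k - int i) i) x +
          (q (int n * (int l - 1) + int k - int i + 1) (if i = 0 then m else i - 1) x
           + u x $$ (i, m) * q (int n * (int l - 1) + int k - int m) m x)
          = q (int n * (int l - 1) + int k - int i + 1) i x"
          using step0[of "int n * (int l - 1) + int k" x] by simp
      next
        case (Suc i')
        have "i' < m" using Suc ik m by simp
        moreover have "int n * (int l - 1) + int k - int i + int (Suc i') - int m
            = int n * (int l - 1) + int k - int m" using Suc by simp
        ultimately show "deriv (q (int n * (int l - 1) + int k - int i) i) x +
          (q (int n * (int l - 1) + int k - int i + 1) (if i = 0 then m else i - 1) x
           + u x $$ (i, m) * q (int n * (int l - 1) + int k - int m) m x)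
          = q (int n * (int l - 1) + int k - int i + 1) i x"
          using stepS[of i' "int n * (int l - 1) + int k - int i" x] Suc by simp
      qed
    qed
    then show "(fps_X \<cdot>\<^sub>m fps_mat_dx n M x + L_mat n (u x) * M x) $$ (i, k)
        = (M x * K_mat n) $$ (i, k)"
      by (rule fps_ext)
  qed (use V_spaceD(1)[OF V, of x] in \<open>auto simp: M_def K_mat_def L_mat_def\<close>)
  \<comment> \<open>At l = 0 the index k - i of \<open>q\<close> is negative below the diagonal and
    0 on it.\<close>
  moreover have "fps_nth (M x $$ (i, k)) 0 = (if i = k then 1 else 0)" if "k \<le> i" "i < n" for x i k
    using that by (auto simp: Mn neg one m)
  ultimately show ?thesis using that[of M] sM by blast
qed

text \<open>The constant coefficient of \<open>det (M x)\<close> is the determinant of an upper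
  unitriangular matrix, hence 1. Dividing the adjugate by \<open>det (M x)\<close> therefore stays
  within power series with smooth coefficients.\<close>

lemma fps_mat_inverse:
  assumes M: "smooth_fps_mat n M"
    and M0: "\<And>x i k. k \<le> i \<Longrightarrow> i < n \<Longrightarrow> fps_nth (M x $$ (i, k)) 0 = (if i = k then 1 else 0)"
  obtains N where "smooth_fps_mat n N" "\<And>x. M x * N x = 1\<^sub>m n" "\<And>x. N x * M x = 1\<^sub>m n"
proof -
  interpret h: comm_ring_hom "\<lambda>f :: real fps. fps_nth f 0"
    by unfold_locales auto
  note Mc = smooth_fps_matD(1)[OF M]
  have d0: "fps_nth (det (M x)) 0 = 1" for x
  proof -
    let ?A = "map_mat (\<lambda>f. fps_nth f 0) (M x)"
    have A: "?A \<in> carrier_mat n n" using Mc by simp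
    have "upper_triangular ?A"
      using Mc[of x] M0 by (auto simp: upper_triangular_def)
    then have "det ?A = prod_list (diag_mat ?A)" by (rule det_upper_triangular[OF _ A])
    also have "diag_mat ?A = map (\<lambda>i. 1) [0..<n]"
      using Mc[of x] M0 by (auto simp: diag_mat_def)
    also have "prod_list \<dots> = 1" by (simp add: map_replicate_const)
    finally show ?thesis by simp
  qed
  define N where "N x = inverse (det (M x)) \<cdot>\<^sub>m adj_mat (M x)" for x
  note a = adj_mat[OF Mc]
  have "smooth_fps (\<lambda>x. inverse (det (M x)))"
    using smooth_fps_det[of M n] smooth_fps_matD[OF M] d0 by (intro smooth_fps_inverse) auto
  then have "smooth_fps_mat n N"
    using smooth_fps_mat_adj[OF M] a(1)
    unfolding smooth_fps_mat_def N_def by (auto intro!: smooth_fps_mult simp: carrier_matD[OF a(1)])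
  moreover have i: "inverse (det (M x)) * det (M x) = 1" for x
    by (rule inverse_mult_eq_1) (simp add: d0)
  have "M x * N x = 1\<^sub>m n" for x
    unfolding N_def mult_smult_distrib[OF Mc a(1)] a(2)
    by (rule eq_matI) (auto simp: i)
  moreover have "N x * M x = 1\<^sub>m n" for x
    unfolding N_def mult_smult_assoc_mat[OF a(1) Mc] a(3)
    by (rule eq_matI) (auto simp: i)
  ultimately show ?thesis using that by blast
qed


section \<open>Conjugation, traces and powers of \<open>K_mat\<close>\<close>

lemma square_mat_simps:
  fixes A B C :: "'a :: comm_ring_1 mat"
  shows "A \<in> carrier_mat n n \<Longrightarrow> B \<in> carrier_mat n n \<Longrightarrow> A * B \<in> carrier_mat n n"
    "A \<in> carrier_mat n n \<Longrightarrow> B \<in> carrier_mat n n \<Longrightarrow> A + B \<in> carrier_mat n n"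
    "A \<in> carrier_mat n n \<Longrightarrow> B \<in> carrier_mat n n \<Longrightarrow> A - B \<in> carrier_mat n n"
    "A \<in> carrier_mat n n \<Longrightarrow> c \<cdot>\<^sub>m A \<in> carrier_mat n n"
    "A \<in> carrier_mat n n \<Longrightarrow> B \<in> carrier_mat n n \<Longrightarrow> C \<in> carrier_mat n n \<Longrightarrow>
      (A * B) * C = A * (B * C)"
    "A \<in> carrier_mat n n \<Longrightarrow> B \<in> carrier_mat n n \<Longrightarrow> C \<in> carrier_mat n n \<Longrightarrow>
      (A + B) * C = A * C + B * C"
    "A \<in> carrier_mat n n \<Longrightarrow> B \<in> carrier_mat n n \<Longrightarrow> C \<in> carrier_mat n n \<Longrightarrow>
      A * (B + C) = A * B + A * C"
    "A \<in> carrier_mat n n \<Longrightarrow> B \<in> carrier_mat n n \<Longrightarrow> C \<in> carrier_mat n n \<Longrightarrow>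
      (A - B) * C = A * C - B * C"
    "A \<in> carrier_mat n n \<Longrightarrow> B \<in> carrier_mat n n \<Longrightarrow> C \<in> carrier_mat n n \<Longrightarrow>
      A * (B - C) = A * B - A * C"
    "A \<in> carrier_mat n n \<Longrightarrow> B \<in> carrier_mat n n \<Longrightarrow> (c \<cdot>\<^sub>m A) * B = c \<cdot>\<^sub>m (A * B)"
    "A \<in> carrier_mat n n \<Longrightarrow> B \<in> carrier_mat n n \<Longrightarrow> A * (c \<cdot>\<^sub>m B) = c \<cdot>\<^sub>m (A * B)"
    "A \<in> carrier_mat n n \<Longrightarrow> B \<in> carrier_mat n n \<Longrightarrow> c \<cdot>\<^sub>m (A + B) = c \<cdot>\<^sub>m A + c \<cdot>\<^sub>m B"
    "A \<in> carrier_mat n n \<Longrightarrow> A * 1\<^sub>m n = A"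
    "A \<in> carrier_mat n n \<Longrightarrow> 1\<^sub>m n * A = A"
    "1\<^sub>m n \<in> carrier_mat n n"
  by (simp_all add: add_mult_distrib_mat mult_add_distrib_mat minus_mult_distrib_mat
      minus_carrier_mat mult_minus_distrib_mat mult_smult_assoc_mat mult_smult_distrib add_smult_distrib_left_mat)

text \<open>A gauge transformation: by \<open>eqM\<close>, M intertwines c d/dx + L with c d/dx + B
  and so carries the covariant derivative of Q to that of P = M Q N. \<open>Mx\<close>,
  \<open>Px\<close>, \<open>Qx\<close> stand for the derivatives, and \<open>dP\<close> is the
  product rule for P M = M Q, a form in which N is never differentiated.\<close>

lemma conj_commutator:
  fixes M N P Q L B Mx Px Qx :: "'a :: comm_ring_1 mat"
  assumes c: "M \<in> carrier_mat n n" "N \<in> carrier_mat n n" "Q \<in> carrier_mat n n"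
    "L \<in> carrier_mat n n" "B \<in> carrier_mat n n" "Mx \<in> carrier_mat n n"
    "Px \<in> carrier_mat n n" "Qx \<in> carrier_mat n n" "P \<in> carrier_mat n n"
    and MN: "M * N = 1\<^sub>m n" and PM: "P * M = M * Q"
    and eqM: "c \<cdot>\<^sub>m Mx + L * M = M * B"
    and dP: "Px * M + P * Mx = Mx * Q + M * Qx"
  shows "c \<cdot>\<^sub>m Px + commutator L P = M * (c \<cdot>\<^sub>m Qx + commutator B Q) * N"
proof -
  note sq = square_mat_simps[where n=n]
  note [simp] = c sq(1-4)
  have e1: "c \<cdot>\<^sub>m (Mx * Q) + L * (M * Q) = M * (B * Q)"
    using arg_cong[OF eqM, of "\<lambda>A. A * Q"] by (simp only: sq c)
  have "P * (M * B) = M * (Q * B)"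
    using sq(5)[OF c(9,1,5)] sq(5)[OF c(1,3,5)] PM by simp
  then have e2: "c \<cdot>\<^sub>m (P * Mx) + P * (L * M) = M * (Q * B)"
    using arg_cong[OF eqM, of "\<lambda>A. P * A"] by (simp only: sq c)
  have e3: "c \<cdot>\<^sub>m (Px * M) + c \<cdot>\<^sub>m (P * Mx) = c \<cdot>\<^sub>m (Mx * Q) + c \<cdot>\<^sub>m (M * Qx)"
    using arg_cong[OF dP, of "\<lambda>A. c \<cdot>\<^sub>m A"] by (simp only: sq c)
  \<comment> \<open>After multiplication by M from the right, \<open>e1\<close>, \<open>e2\<close>
    and \<open>e3\<close> suffice; N returns only at the end.\<close>
  have "(c \<cdot>\<^sub>m Px + commutator L P) * M
      = c \<cdot>\<^sub>m (Px * M) + (L * (M * Q) - P * (L * M))"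
    unfolding commutator_def by (simp only: sq c PM)
  also have "\<dots> = c \<cdot>\<^sub>m (M * Qx) + (M * (B * Q) - M * (Q * B))"
  proof (rule eq_matI)
    fix i k assume "i < dim_row (c \<cdot>\<^sub>m (M * Qx) + (M * (B * Q) - M * (Q * B)))"
      "k < dim_col (c \<cdot>\<^sub>m (M * Qx) + (M * (B * Q) - M * (Q * B)))"
    then have ik: "i < n" "k < n" by (simp_all add: carrier_matD[of _ n n])
    have idx: "(X + Y) $$ (i, k) = X $$ (i, k) + Y $$ (i, k)"
      "(X - Y) $$ (i, k) = X $$ (i, k) - Y $$ (i, k)"
      if "Y \<in> carrier_mat n n" for X Y :: "'a mat"
      using that ik by simp_all
    have E1: "(c \<cdot>\<^sub>m (Mx * Q)) $$ (i, k) + (L * (M * Q)) $$ (i, k) = (M * (B * Q)) $$ (i, k)"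
      using arg_cong[OF e1, of "\<lambda>A. A $$ (i, k)"]
      by (subst (asm) idx) (simp_all del: index_smult_mat index_mult_mat)
    have E2: "(c \<cdot>\<^sub>m (P * Mx)) $$ (i, k) + (P * (L * M)) $$ (i, k) = (M * (Q * B)) $$ (i, k)"
      using arg_cong[OF e2, of "\<lambda>A. A $$ (i, k)"]
      by (subst (asm) idx) (simp_all del: index_smult_mat index_mult_mat)
    have E3: "(c \<cdot>\<^sub>m (Px * M)) $$ (i, k) + (c \<cdot>\<^sub>m (P * Mx)) $$ (i, k)
        = (c \<cdot>\<^sub>m (Mx * Q)) $$ (i, k) + (c \<cdot>\<^sub>m (M * Qx)) $$ (i, k)"
      using arg_cong[OF e3, of "\<lambda>A. A $$ (i, k)"]
      by (subst (asm) (1 2) idx) (simp_all del: index_smult_mat index_mult_mat)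
    have "(c \<cdot>\<^sub>m (Px * M)) $$ (i, k) + ((L * (M * Q)) $$ (i, k) - (P * (L * M)) $$ (i, k))
      = (c \<cdot>\<^sub>m (M * Qx)) $$ (i, k) + ((M * (B * Q)) $$ (i, k) - (M * (Q * B)) $$ (i, k))"
    proof -
      have "(c \<cdot>\<^sub>m (Px * M)) $$ (i, k)
          = (c \<cdot>\<^sub>m (Mx * Q)) $$ (i, k) + (c \<cdot>\<^sub>m (M * Qx)) $$ (i, k) - (c \<cdot>\<^sub>m (P * Mx)) $$ (i, k)"
        using E3 by (simp only: eq_diff_eq)
      then show ?thesis unfolding E1[symmetric] E2[symmetric] by (simp only: algebra_simps)
    qed
    then show "(c \<cdot>\<^sub>m (Px * M) + (L * (M * Q) - P * (L * M))) $$ (i, k)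
        = (c \<cdot>\<^sub>m (M * Qx) + (M * (B * Q) - M * (Q * B))) $$ (i, k)"
      by (simp add: idx del: index_smult_mat index_mult_mat index_add_mat index_minus_mat)
  qed (simp_all add: carrier_matD[of _ n n])
  also have "\<dots> = M * (c \<cdot>\<^sub>m Qx + commutator B Q)"
    unfolding commutator_def
    by (simp only: sq c)
  finally have e: "(c \<cdot>\<^sub>m Px + commutator L P) * M = M * (c \<cdot>\<^sub>m Qx + commutator B Q)" .
  have C: "c \<cdot>\<^sub>m Px + commutator L P \<in> carrier_mat n n"
    unfolding commutator_def by (simp only: sq c)
  have "c \<cdot>\<^sub>m Px + commutator L P = (c \<cdot>\<^sub>m Px + commutator L P) * (M * N)"
    by (simp only: MN sq C)
  also have "\<dots> = (c \<cdot>\<^sub>m Px + commutator L P) * M * N"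
    by (simp only: sq(5)[OF C c(1,2)])
  finally show ?thesis unfolding e .
qed

lemma fps_mat_conj_commutator:
  assumes M: "smooth_fps_mat n M" and N: "smooth_fps_mat n N" and Q: "smooth_fps_mat n Q"
    and L: "L \<in> carrier_mat n n" and B: "B \<in> carrier_mat n n"
    and MN: "\<And>x. M x * N x = 1\<^sub>m n" and NM: "\<And>x. N x * M x = 1\<^sub>m n"
    and eqM: "fps_X \<cdot>\<^sub>m fps_mat_dx n M x + L * M x = M x * B"
  shows "fps_X \<cdot>\<^sub>m fps_mat_dx n (\<lambda>x. M x * Q x * N x) x + commutator L (M x * Q x * N x)
    = M x * (fps_X \<cdot>\<^sub>m fps_mat_dx n Q x + commutator B (Q x)) * N x"
proof -
  note c = smooth_fps_matD(1)[OF M] smooth_fps_matD(1)[OF N] smooth_fps_matD(1)[OF Q]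
  let ?P = "\<lambda>x. M x * Q x * N x"
  have P: "smooth_fps_mat n ?P" by (intro smooth_fps_mat_mult M N Q)
  have PM: "?P x * M x = M x * Q x" for x
    by (simp only: square_mat_simps[where n=n] c NM)
  have "fps_mat_dx n ?P x * M x + ?P x * fps_mat_dx n M x
      = fps_mat_dx n M x * Q x + M x * fps_mat_dx n Q x"
    unfolding fps_mat_dx_mult[OF P M, symmetric] fps_mat_dx_mult[OF M Q, symmetric] PM ..
  then show ?thesis
    by (intro conj_commutator[OF c(1) c(2) c(3) L B _ _ _ smooth_fps_matD(1)[OF P] MN PM eqM]) auto
qed

definition tr :: "'a :: comm_ring_1 mat \<Rightarrow> 'a" where
  "tr A = (\<Sum>i<dim_row A. A $$ (i, i))"

lemma tr_mult_comm:
  assumes A: "A \<in> carrier_mat n n" and B: "B \<in> carrier_mat n n"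
  shows "tr (A * B) = tr (B * A)"
proof -
  have "tr (A * B) = (\<Sum>i<n. \<Sum>l<n. A $$ (i, l) * B $$ (l, i))"
    unfolding tr_def using A B by (auto simp: mult_mat_index[OF A B] simp del: index_mult_mat(1) intro: sum.cong)
  also have "\<dots> = (\<Sum>l<n. \<Sum>i<n. B $$ (l, i) * A $$ (i, l))"
    by (subst sum.swap) (simp add: mult.commute)
  also have "\<dots> = tr (B * A)"
    unfolding tr_def using A B by (auto simp: mult_mat_index[OF B A] simp del: index_mult_mat(1) intro: sum.cong)
  finally show ?thesis .
qed

lemma conj_pow:
  fixes M N A :: "'a :: comm_ring_1 mat"
  assumes c: "M \<in> carrier_mat n n" "N \<in> carrier_mat n n" "A \<in> carrier_mat n n"
    and MN: "M * N = 1\<^sub>m n" and NM: "N * M = 1\<^sub>m n"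
  shows "(M * A * N) ^\<^sub>m j = M * A ^\<^sub>m j * N"
proof (induction j)
  case 0
  then show ?case using c MN by simp
next
  case (Suc j)
  note sq = square_mat_simps[where n=n]
  have p: "A ^\<^sub>m j \<in> carrier_mat n n" using c by simp
  have "(M * A * N) ^\<^sub>m Suc j = M * (A ^\<^sub>m j * ((N * M) * (A * N)))"
    unfolding pow_mat.simps Suc.IH by (simp only: sq c p)
  also have "\<dots> = M * A ^\<^sub>m Suc j * N" by (simp only: pow_mat.simps NM sq c p)
  finally show ?case .
qed

text \<open>J^j shifts by j places cyclically, and an entry that wraps around carries one \<lambda>,
  visible here as one factor \<open>fps_X\<close> less. For j = n this is J^n = \<lambda>.\<close>

lemma K_mat_pow_index:
  assumes "i < n" "k < n" "j \<le> n"
  shows "(K_mat n ^\<^sub>m j) $$ (i, k) =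
    (if i = k + j then fps_X ^ j else if i + n = k + j \<and> j > 0 then fps_X ^ (j - 1) else 0)"
  using assms
proof (induction j arbitrary: k)
  case 0
  then show ?case by (simp add: K_mat_def)
next
  case (Suc j)
  have c: "K_mat n ^\<^sub>m j \<in> carrier_mat n n" by simp
  show ?case
  proof (cases "Suc k < n")
    case True
    show ?thesis
      unfolding pow_mat.simps mult_K_mat_index(2)[OF c Suc.prems(1) True]
      using Suc True by (cases j) auto
  next
    case False
    then have k: "k = n - 1" using Suc.prems by simp
    show ?thesis
      unfolding pow_mat.simps k mult_K_mat_index(1)[OF c Suc.prems(1)]
      using Suc by auto
  qed
qed

lemma K_mat_pow_n: "n > 0 \<Longrightarrow> K_mat n ^\<^sub>m n = fps_X ^ (n - 1) \<cdot>\<^sub>m 1\<^sub>m n"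
  by (rule eq_matI) (auto simp: K_mat_pow_index carrier_matD[OF K_mat_carrier])

text \<open>Each factor raises row minus column by 1 modulo n. On the diagonal the congruence says
  that n divides j.\<close>

lemma K_mat_pow_nonzero:
  assumes "i < n" "k < n" "(K_mat n ^\<^sub>m j) $$ (i, k) \<noteq> 0"
  shows "int n dvd int i - int k - int j"
  using assms
proof (induction j arbitrary: k)
  case 0
  then show ?case by (simp add: K_mat_def split: if_splits)
next
  case (Suc j)
  have c: "K_mat n ^\<^sub>m j \<in> carrier_mat n n" by simp
  show ?case
  proof (cases "Suc k < n")
    case True
    then have "(K_mat n ^\<^sub>m j) $$ (i, Suc k) \<noteq> 0"
      using Suc.prems(3) unfolding pow_mat.simps mult_K_mat_index(2)[OF c Suc.prems(1) True] by auto
    then show ?thesis using Suc.IH[of "Suc k"] Suc.prems True by (simp add: algebra_simps)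
  next
    case False
    then have k: "k = n - 1" using Suc.prems by simp
    have "(K_mat n ^\<^sub>m j) $$ (i, 0) \<noteq> 0"
      using Suc.prems(3) unfolding pow_mat.simps k mult_K_mat_index(1)[OF c Suc.prems(1)] by auto
    then have "int n dvd int i - int j" using Suc.IH[of 0] Suc.prems by simp
    then have "int n dvd int i - int j - int n" by simp
    then show ?thesis using Suc.prems by (simp add: k of_nat_diff algebra_simps)
  qed
qed

lemma tr_K_mat_pow:
  assumes "j mod n \<noteq> 0"
  shows "tr (K_mat n ^\<^sub>m j) = 0"
proof -
  have "(K_mat n ^\<^sub>m j) $$ (i, i) = 0" if "i < n" for i
  proof (rule ccontr)
    assume "(K_mat n ^\<^sub>m j) $$ (i, i) \<noteq> 0"
    from K_mat_pow_nonzero[OF that that this] have "n dvd j" by simp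
    with assms show False by simp
  qed
  then show ?thesis unfolding tr_def by (simp add: carrier_matD[OF K_mat_carrier])
qed


text \<open>The conditions on \<open>P = \<lambda>\<^sup>-\<^sup>1 Y\<close>.\<close>

definition is_P_series :: "nat \<Rightarrow> (real \<Rightarrow> real mat) \<Rightarrow> (real \<Rightarrow> real fps mat) \<Rightarrow> bool" where
  "is_P_series n u P \<longleftrightarrow> smooth_fps_mat n P \<and>
     (\<forall>x. map_mat (\<lambda>f. fps_nth f 0) (P x) = elem_mat n 0 (n - 1)) \<and>
     (\<forall>x. fps_X \<cdot>\<^sub>m fps_mat_dx n P x + commutator (L_mat n (u x)) (P x) = 0\<^sub>m n n) \<and>
     (\<forall>x. P x ^\<^sub>m n = fps_X ^ (n - 1) \<cdot>\<^sub>m 1\<^sub>m n)"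

section \<open>Solutions of the equation for u = 0\<close>

lemma fps_nth_0_hom: "comm_ring_hom (\<lambda>f :: 'a :: comm_ring_1 fps. fps_nth f 0)"
  by unfold_locales auto

text \<open>Meant for conjugation by the constant coefficient of the dressing matrix: its first
  column and last row are those of the identity, and products with e_1n see nothing else.\<close>

lemma unitriangular_elem_mat:
  fixes M :: "real mat"
  assumes M: "M \<in> carrier_mat n n"
    and M0: "\<And>i k. k \<le> i \<Longrightarrow> i < n \<Longrightarrow> M $$ (i, k) = (if i = k then 1 else 0)"
  shows "M * elem_mat n 0 (n - 1) = elem_mat n 0 (n - 1)"
    "elem_mat n 0 (n - 1) * M = elem_mat n 0 (n - 1)"
proof -
  let ?e = "elem_mat n 0 (n - 1) :: real mat"
  have e: "?e \<in> carrier_mat n n" by (simp add: elem_mat_def)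
  have "(M * ?e) $$ (i, k) = ?e $$ (i, k)" if "i < n" "k < n" for i k
  proof -
    have "(M * ?e) $$ (i, k) = (\<Sum>l<n. if l = 0 then M $$ (i, 0) * ?e $$ (0, k) else 0)"
      unfolding mult_mat_index[OF M e that] using that by (intro sum.cong) (auto simp: elem_mat_def)
    then show ?thesis using that by (auto simp: M0 elem_mat_def)
  qed
  then show "M * ?e = ?e" using M e by (intro eq_matI) (auto simp del: index_mult_mat(1))
  have "(?e * M) $$ (i, k) = ?e $$ (i, k)" if "i < n" "k < n" for i k
  proof -
    have "(?e * M) $$ (i, k) = (\<Sum>l<n. if l = n - 1 then ?e $$ (i, n - 1) * M $$ (n - 1, k) else 0)"
      unfolding mult_mat_index[OF e M that] using that by (intro sum.cong) (auto simp: elem_mat_def)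
    also have "\<dots> = ?e $$ (i, n - 1) * M $$ (n - 1, k)" using that by simp
    also have "M $$ (n - 1, k) = (if n - 1 = k then 1 else 0)" using that by (intro M0) auto
    finally show ?thesis using that by (auto simp: elem_mat_def)
  qed
  then show "?e * M = ?e" using M e by (intro eq_matI) (auto simp del: index_mult_mat(1))
qed

text \<open>Q is \<lambda>^(-1) times a solution for u = 0, and \<open>c d\<close> is the factor of
  J^d in that solution: d = n (1 - l) + i - k is the degree of \<lambda>^(1-l) e_ik. The last two
  conclusions say that the part of highest degree is J.\<close>

lemma constant_diagonals:
  assumes n: "n \<ge> 2" and Q: "smooth_fps_mat n Q"
    and Q0: "\<And>x. map_mat (\<lambda>f. fps_nth f 0) (Q x) = elem_mat n 0 (n - 1)"
    and eq: "\<And>x. fps_X \<cdot>\<^sub>m fps_mat_dx n Q x + commutator (K_mat n) (Q x) = 0\<^sub>m n n"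
  obtains c :: "int \<Rightarrow> real" where
    "\<And>i k l x. i < n \<Longrightarrow> k < n \<Longrightarrow>
       fps_nth (Q x $$ (i, k)) l = c (int n * (1 - int l) + int i - int k)"
    "\<And>d. d \<ge> 2 \<Longrightarrow> c d = 0" "c 1 = 1"
proof -
  note Qc = smooth_fps_matD(1)[OF Q]
  have Q00: "fps_nth (Q x $$ (i, k)) 0 = (if i = 0 \<and> k = n - 1 then 1 else 0)"
    if "i < n" "k < n" for x i k
    using arg_cong[OF Q0[of x], of "\<lambda>A. A $$ (i, k)"] that Qc[of x] by (simp add: elem_mat_def)
  \<comment> \<open>Reading row \<open>i\<close> at \<open>\<lambda>\<^sup>m\<close> as position \<open>n m + i\<close> turns \<open>J\<close> into a shift of every column.\<close>
  define E where "E s k x = (if s \<ge> 2 * int n then 0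
      else fps_nth (Q x $$ (nat (s mod int n), k)) (nat (1 - s div int n)))" for s :: int and k x
  have EQ: "E (int n * (1 - int l) + int i) k x = fps_nth (Q x $$ (i, k)) l"
    if "i < n" for i k l x
  proof -
    have "int n * (1 - int l) + int i < 2 * int n"
    proof -
      have "int n * (1 - int l) \<le> int n * 1" by (intro mult_left_mono) auto
      then have "int n * (1 - int l) \<le> int n" by (simp only: mult_1_right)
      then show ?thesis using that by linarith
    qed
    moreover have "(int n * (1 - int l) + int i) mod int n = int i" using that by simp
    moreover have "(int n * (1 - int l) + int i) div int n = 1 - int l" using that by simp
    ultimately show ?thesis by (simp add: E_def)
  qed
  have decomp: "\<exists>l i. i < n \<and> s = int n * (1 - int l) + int i" if "s < 2 * int n" for s
  proof -
    have "s div int n \<le> 1"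
    proof (rule ccontr)
      assume "\<not> s div int n \<le> 1"
      then have "int n * 2 \<le> int n * (s div int n)" by (intro mult_left_mono) auto
      also have "\<dots> \<le> s" using n mult_div_mod_eq[of "int n" s] pos_mod_sign[of "int n" s] by linarith
      finally show False using that by simp
    qed
    then have "s = int n * (1 - int (nat (1 - s div int n))) + int (nat (s mod int n))"
      using n by simp
    moreover have "nat (s mod int n) < n" using n by (simp add: nat_less_iff)
    ultimately show ?thesis by blast
  qed
  have Elarge: "E s k x = (if s = int n \<and> k = n - 1 then 1 else 0)" if "s \<ge> int n" "k < n" for s k x
  proof (cases "s \<ge> 2 * int n")
    case True
    then show ?thesis using n by (simp add: E_def)
  next
    case False
    define i where "i = nat (s - int n)"
    have ii: "int i = s - int n" using that(1) by (simp add: i_def)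
    then have i: "i < n" "s = int n * (1 - int 0) + int i" using False by auto
    show ?thesis unfolding i(2) EQ[OF i(1)] Q00[OF i(1) that(2)] by simp
  qed
  have smE: "smooth_fun (E s k)" if "k < n" for s k
  proof -
    have "smooth_fun (\<lambda>x. fps_nth (Q x $$ (nat (s mod int n), k)) l)" for l
      using smooth_fps_matD(2)[OF Q, of "nat (s mod int n)" k] that n
      by (simp add: smooth_fps_def nat_less_iff)
    then show ?thesis unfolding E_def by (cases "2 * int n \<le> s") simp_all
  qed
  \<comment> \<open>Left multiplication by J is the shift by one position. Right multiplication by J
    puts column k + 1 into column k, and \<lambda> times column 0 into the last one; \<lambda> is a
    shift by n positions.\<close>
  have Eeq: "deriv (E s k) x + E (s - 1) k x = (if k = n - 1 then E (s - int n) 0 x else E s (Suc k) x)"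
    if k: "k < n" for s k x
  proof (cases "s < 2 * int n")
    case False
    have "E s k = (\<lambda>x. 0)" using False by (auto simp: E_def)
    then have "deriv (E s k) x = 0" by simp
    then show ?thesis using False k n by (auto simp: Elarge)
  next
    case True
    then obtain l i where i: "i < n" and s: "s = int n * (1 - int l) + int i" using decomp by blast
    have "(fps_X \<cdot>\<^sub>m fps_mat_dx n Q x + commutator (K_mat n) (Q x)) $$ (i, k) = 0"
      using eq i k by simp
    then have "fps_X * fps_mat_dx n Q x $$ (i, k) + (K_mat n * Q x) $$ (i, k)
        = (Q x * K_mat n) $$ (i, k)"
      using i k Qc[of x] carrier_matD[OF K_mat_carrier[of n]] carrier_matD[OF fps_mat_dx_carrier[of n Q x]]
      unfolding commutator_def by (simp add: add_diff_eq del: index_mult_mat(1))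
    then have "fps_nth (fps_X * fps_mat_dx n Q x $$ (i, k)) (Suc l)
        + fps_nth ((K_mat n * Q x) $$ (i, k)) (Suc l) = fps_nth ((Q x * K_mat n) $$ (i, k)) (Suc l)"
      by (metis fps_add_nth)
    moreover have "fps_nth (fps_X * fps_mat_dx n Q x $$ (i, k)) (Suc l) = deriv (E s k) x"
    proof -
      have "E s k = (\<lambda>x. fps_nth (Q x $$ (i, k)) l)" using EQ[OF i] s by auto
      then show ?thesis using i k by (simp add: fps_mat_dx_def)
    qed
    moreover have "fps_nth ((K_mat n * Q x) $$ (i, k)) (Suc l) = E (s - 1) k x"
    proof (cases i)
      case 0
      have e: "s - 1 = int n * (1 - int (Suc l)) + int (n - 1)"
        using n by (simp add: s 0 algebra_simps of_nat_diff)
      have lt: "n - 1 < n" using n by simp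
      show ?thesis unfolding e EQ[OF lt] 0 K_mat_mult_index(1)[OF Qc k] ..
    next
      case (Suc i')
      have e: "s - 1 = int n * (1 - int l) + int i'" by (simp add: s Suc)
      have lt: "i' < n" "Suc i' < n" using Suc i by simp_all
      show ?thesis unfolding e EQ[OF lt(1)] Suc K_mat_mult_index(2)[OF Qc k lt(2)] by simp
    qed
    moreover have "fps_nth ((Q x * K_mat n) $$ (i, k)) (Suc l)
        = (if k = n - 1 then E (s - int n) 0 x else E s (Suc k) x)"
    proof (cases "k = n - 1")
      case True
      have e: "s - int n = int n * (1 - int (Suc l)) + int i" by (simp add: s algebra_simps)
      show ?thesis unfolding e EQ[OF i] True mult_K_mat_index(1)[OF Qc i] by simp
    next
      case False
      then have lt: "Suc k < n" using k by simp
      show ?thesis unfolding s EQ[OF i] mult_K_mat_index(2)[OF Qc i lt] using False by simp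
    qed
    ultimately show ?thesis by simp
  qed
  \<comment> \<open>\<open>G d\<close> is the diagonal of degree d = s - k. In these coordinates
    \<open>Eeq\<close> couples only the degrees d and d - 1, cyclically in k.\<close>
  define G where "G d k = E (d + int k) k" for d k
  have Geq: "deriv (G d k) x + G (d - 1) k x = G (d - 1) (if k = n - 1 then 0 else Suc k) x"
    if "k < n" for d k x
    using Eeq[OF that, of "d + int k" x] n by (auto simp: G_def algebra_simps of_nat_diff)
  \<comment> \<open>Downwards from d = n + 1, where everything vanishes. Once degree d is constant,
    \<open>Geq\<close> makes degree d - 1 independent of k; summing \<open>Geq\<close> for d - 1
    around the cycle then makes the derivative vanish.\<close>
  have const: "\<exists>c. \<forall>k<n. \<forall>x. G d k x = c" if "d \<le> int n + 1" for d
    using that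
  proof (induction d rule: int_le_induct)
    case base
    have "G (int n + 1) k x = 0" if "k < n" for k x
      using that by (simp add: G_def Elarge)
    then show ?case by blast
  next
    case (step d)
    then obtain c where c: "\<And>k x. k < n \<Longrightarrow> G d k x = c" by blast
    have eqk: "G (d - 1) k x = G (d - 1) 0 x" if "k < n" for k x
      using that
    proof (induction k)
      case (Suc k)
      have "G d k = (\<lambda>x. c)" using c Suc.prems by auto
      then have d0: "deriv (G d k) x = 0" by simp
      have k: "k < n" "k \<noteq> n - 1" using Suc.prems by auto
      have "G (d - 1) k x = G (d - 1) (Suc k) x"
        using Geq[OF k(1), of d x] unfolding d0 if_not_P[OF k(2)] by (simp only: add_0)
      then show ?case using Suc.IH[OF k(1)] by (simp only:)
    qed simp
    have "deriv (G (d - 1) 0) x = 0" for x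
    proof -
      define h where "h k = G (d - 1 - 1) k x" for k
      have Gk: "G (d - 1) k = G (d - 1) 0" if "k < n" for k using eqk[OF that] by (intro ext)
      have a: "h (if k = n - 1 then 0 else Suc k) - h k = deriv (G (d - 1) 0) x" if "k < n" for k
        using Geq[OF that, of "d - 1" x] unfolding Gk[OF that] h_def by linarith
      have "(\<Sum>k<n. h (if k = n - 1 then 0 else Suc k) - h k) = (\<Sum>k<n. deriv (G (d - 1) 0) x)"
        by (intro sum.cong refl a) simp
      then have "real n * deriv (G (d - 1) 0) x = (\<Sum>k<n. h (if k = n - 1 then 0 else Suc k) - h k)"
        by simp
      also have "\<dots> = (\<Sum>k<Suc (n - 1). h (if k = n - 1 then 0 else Suc k) - h k)"
        using n by simp
      also have "\<dots> = (\<Sum>k<n - 1. h (Suc k) - h k) + (h 0 - h (n - 1))"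
        unfolding sum.lessThan_Suc by (intro arg_cong2[of _ _ _ _ "(+)"] sum.cong) auto
      also have "\<dots> = 0" by (simp add: sum_lessThan_telescope)
      finally show ?thesis using n by simp
    qed
    moreover have "smooth_fun (G (d - 1) 0)" unfolding G_def using n by (intro smE) simp
    ultimately have "(G (d - 1) 0 has_field_derivative 0) (at x)" for x
      using smooth_fun_has_deriv[of "G (d - 1) 0" x] by simp
    then have "G (d - 1) 0 x = G (d - 1) 0 0" for x using DERIV_isconst_all[of "G (d - 1) 0"] by blast 
    then show ?case using eqk by (intro exI[of _ "G (d - 1) 0 0"]) metis
  qed
  define c where "c d = (if d \<le> int n then G d 0 0 else 0)" for d
  have cG: "G d k x = c d" if "k < n" for d k x
  proof (cases "d \<le> int n")
    case True
    then obtain c' where "\<forall>k<n. \<forall>x. G d k x = c'" using const[of d] by auto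
    then show ?thesis using that True n by (simp add: c_def)
  next
    case False
    then show ?thesis using that by (simp add: c_def G_def Elarge)
  qed
  have 1: "fps_nth (Q x $$ (i, k)) l = c (int n * (1 - int l) + int i - int k)"
    if "i < n" "k < n" for i k l x
    using cG[OF that(2), of "int n * (1 - int l) + int i - int k" x] EQ[OF that(1), of l k x]
    by (simp add: G_def)
  \<comment> \<open>Row 0 of the \<lambda>^1 coefficient e_1n meets the degrees 1 to n, and its only
    nonzero entry has degree 1.\<close>
  have cn: "c (int n - int k) = (if k = n - 1 then 1 else 0)" if "k < n" for k
    using cG[OF that, of "int n - int k" 0] Elarge[of "int n" k 0] that by (simp add: G_def)
  have 2: "c d = 0" if "d \<ge> 2" for d
  proof (cases "d \<le> int n")
    case True
    define k where "k = nat (int n - d)"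
    have "d = int n - int k" "k < n - 1" using True that n by (auto simp: k_def)
    then show ?thesis using cn[of k] by simp
  qed (simp add: c_def)
  have 3: "c 1 = 1"
    using cn[of "n - 1"] n by (simp add: of_nat_diff)
  show ?thesis using that[of c] 1 2 3 by blast
qed

text \<open>The adjugate turns S T = 0 into \<open>det S\<close> times T = 0, and power series have
  no zero divisors.\<close>

lemma mat_zero_divisor:
  fixes S T :: "real fps mat"
  assumes S: "S \<in> carrier_mat n n" and T: "T \<in> carrier_mat n n" and d: "det S \<noteq> 0"
    and ST: "S * T = 0\<^sub>m n n"
  shows "T = 0\<^sub>m n n"
proof -
  note a = adj_mat[OF S]
  have "det S \<cdot>\<^sub>m T = (adj_mat S * S) * T" using T by (simp add: a(3) mult_smult_assoc_mat[of _ n n])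
  also have "\<dots> = adj_mat S * (S * T)" by (rule assoc_mult_mat[OF a(1) S T])
  also have "\<dots> = 0\<^sub>m n n" using a(1) by (simp add: ST)
  finally have e: "det S \<cdot>\<^sub>m T = 0\<^sub>m n n" .
  show ?thesis
  proof (rule eq_matI)
    fix i k assume "i < dim_row (0\<^sub>m n n :: real fps mat)" "k < dim_col (0\<^sub>m n n :: real fps mat)"
    then show "T $$ (i, k) = 0\<^sub>m n n $$ (i, k)"
      using arg_cong[OF e, of "\<lambda>A. A $$ (i, k)"] T d by simp
  qed (use T in auto)
qed

text \<open>0 = W^n - 1 = S (W - 1) with S = 1 + W + ... + W^(n-1). The constant coefficient of S is
  upper triangular with n on the diagonal, so \<open>det S\<close> is nonzero in characteristic 0
  and W - 1 must vanish.\<close>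

lemma unipotent_root_of_unity:
  fixes W :: "real fps mat"
  assumes W: "W \<in> carrier_mat n n" and n: "n > 0"
    and W0: "\<And>i k. k \<le> i \<Longrightarrow> i < n \<Longrightarrow> fps_nth (W $$ (i, k)) 0 = (if i = k then 1 else 0)"
    and Wn: "W ^\<^sub>m n = 1\<^sub>m n"
  shows "W = 1\<^sub>m n"
proof -
  interpret h: comm_ring_hom "\<lambda>f :: real fps. fps_nth f 0" by (rule fps_nth_0_hom)
  note sq = square_mat_simps[where n=n]
  \<comment> \<open>Horner form of the geometric sum: \<open>S a\<close> is 1 + W + ... +
    W^(a-1).\<close>
  define S where "S = rec_nat (0\<^sub>m n n) (\<lambda>_ A. A * W + 1\<^sub>m n)"
  have S_simps: "S 0 = 0\<^sub>m n n" "S (Suc a) = S a * W + 1\<^sub>m n" for a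
    by (simp_all add: S_def)
  have S: "S a \<in> carrier_mat n n" for a
    by (induction a) (simp_all add: S_simps)
  have SW: "S a * (W - 1\<^sub>m n) = W ^\<^sub>m a - 1\<^sub>m n" for a
  proof (induction a)
    case 0
    then show ?case using W by (intro eq_matI) (auto simp: S_simps)
  next
    case (Suc a)
    have p: "W ^\<^sub>m a \<in> carrier_mat n n" using W by simp
    have D: "W - 1\<^sub>m n \<in> carrier_mat n n" by (simp only: sq W)
    have "W * (W - 1\<^sub>m n) = (W - 1\<^sub>m n) * W" by (simp only: sq W)
    then have "S (Suc a) * (W - 1\<^sub>m n) = S a * (W - 1\<^sub>m n) * W + (W - 1\<^sub>m n)"
      by (simp only: S_simps sq(1-7,13-15) S W D)
    also have "\<dots> = W ^\<^sub>m a * W - W + (W - 1\<^sub>m n)"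
      unfolding Suc.IH by (simp only: sq W p)
    also have "\<dots> = W ^\<^sub>m Suc a - 1\<^sub>m n"
      using W p by (intro eq_matI) (auto simp del: index_mult_mat(1))
    finally show ?case .
  qed
  have S0: "fps_nth (S a $$ (i, k)) 0 = (if i = k then real a else 0)" if "k \<le> i" "i < n" for a i k
    using that
  proof (induction a arbitrary: i k)
    case 0
    then show ?case by (simp add: S_simps)
  next
    case (Suc a)
    have ik: "i < n" "k < n" using Suc.prems by auto
    have "fps_nth ((S a * W) $$ (i, k)) 0
        = (\<Sum>l<n. fps_nth (S a $$ (i, l)) 0 * fps_nth (W $$ (l, k)) 0)"
      by (simp add: mult_mat_index[OF S W ik] fps_sum_nth del: index_mult_mat(1))
    also have "\<dots> = (\<Sum>l<n. if l = i then (if i = k then real a else 0) else 0)"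
    proof (rule sum.cong)
      fix l assume l: "l \<in> {..<n}"
      show "fps_nth (S a $$ (i, l)) 0 * fps_nth (W $$ (l, k)) 0
          = (if l = i then (if i = k then real a else 0) else 0)"
        \<comment> \<open>For l > i the second factor vanishes because k <= i < l, for l < i the
          first one does.\<close>
        using Suc.IH[of l i] W0[of k l] Suc.prems l by (cases "l \<le> i") auto
    qed simp
    also have "\<dots> = (if i = k then real a else 0)" using ik by simp
    finally show ?case using ik S[of a] W
      by (simp add: S_simps del: index_mult_mat(1))
  qed
  let ?A = "map_mat (\<lambda>f. fps_nth f 0) (S n)"
  have A: "?A \<in> carrier_mat n n" using S by simp
  have "upper_triangular ?A" using S[of n] S0 by (auto simp: upper_triangular_def)
  then have "det ?A = prod_list (diag_mat ?A)" by (rule det_upper_triangular[OF _ A])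
  also have "diag_mat ?A = map (\<lambda>i. real n) [0..<n]" using S[of n] S0 by (auto simp: diag_mat_def)
  also have "prod_list \<dots> = real n ^ n" by (simp add: map_replicate_const)
  finally have "fps_nth (det (S n)) 0 \<noteq> 0" using n by simp
  then have dS: "det (S n) \<noteq> 0" by auto
  have SWn: "S n * (W - 1\<^sub>m n) = 0\<^sub>m n n" by (simp add: SW Wn)
  have "W - 1\<^sub>m n \<in> carrier_mat n n" by (simp only: sq W)
  then have "W - 1\<^sub>m n = 0\<^sub>m n n" by (rule mat_zero_divisor[OF S _ dS SWn])
  then have z: "(W - 1\<^sub>m n) $$ (i, k) = 0" if "i < n" "k < n" for i k using that by simp
  show ?thesis
  proof (rule eq_matI)
    fix i k assume "i < dim_row (1\<^sub>m n :: real fps mat)" "k < dim_col (1\<^sub>m n :: real fps mat)"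
    then show "W $$ (i, k) = 1\<^sub>m n $$ (i, k)" using z[of i k] W by simp
  qed (use W in auto)
qed

lemma commuting_mult_pow:
  fixes A B :: "'a :: comm_ring_1 mat"
  assumes c: "A \<in> carrier_mat n n" "B \<in> carrier_mat n n" and AB: "A * B = B * A"
  shows "(A * B) ^\<^sub>m j = A ^\<^sub>m j * B ^\<^sub>m j"
proof (induction j)
  case 0
  then show ?case using c by simp
next
  case (Suc j)
  note sq = square_mat_simps[where n=n]
  have p: "A ^\<^sub>m j \<in> carrier_mat n n" "B ^\<^sub>m j \<in> carrier_mat n n" using c by auto
  have comm: "B ^\<^sub>m j * A = A * B ^\<^sub>m j" for j
  proof (induction j)
    case 0
    then show ?case using c by simp
  next
    case (Suc j)
    have q: "B ^\<^sub>m j \<in> carrier_mat n n" using c by auto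
    have "B ^\<^sub>m Suc j * A = B ^\<^sub>m j * (A * B)" unfolding AB pow_mat.simps by (simp only: sq c q)
    also have "\<dots> = (B ^\<^sub>m j * A) * B" by (simp only: sq c q)
    also have "\<dots> = A * B ^\<^sub>m Suc j" unfolding Suc.IH pow_mat.simps by (simp only: sq c q)
    finally show ?case .
  qed
  have "(A * B) ^\<^sub>m Suc j = A ^\<^sub>m j * ((B ^\<^sub>m j * A) * B)"
    unfolding pow_mat.simps Suc.IH by (simp only: sq c p)
  also have "\<dots> = A ^\<^sub>m Suc j * B ^\<^sub>m Suc j"
    unfolding comm pow_mat.simps by (simp only: sq c p)
  finally show ?case .
qed

text \<open>Q = K W, where W has only non-positive powers of J and leading term 1. As W commutes
  with K and K^n has the prescribed value, W^n = 1 follows, and then W = 1.\<close>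

lemma undressed_unique:
  assumes n: "n \<ge> 2" and Q: "smooth_fps_mat n Q"
    and Q0: "\<And>x. map_mat (\<lambda>f. fps_nth f 0) (Q x) = elem_mat n 0 (n - 1)"
    and eq: "\<And>x. fps_X \<cdot>\<^sub>m fps_mat_dx n Q x + commutator (K_mat n) (Q x) = 0\<^sub>m n n"
    and pow: "\<And>x. Q x ^\<^sub>m n = fps_X ^ (n - 1) \<cdot>\<^sub>m 1\<^sub>m n"
  shows "Q x = K_mat n"
proof -
  note Qc = smooth_fps_matD(1)[OF Q, of x]
  have n0: "n > 0" using n by simp
  obtain c :: "int \<Rightarrow> real" where
    cQ: "\<And>i k l x. i < n \<Longrightarrow> k < n \<Longrightarrow>
       fps_nth (Q x $$ (i, k)) l = c (int n * (1 - int l) + int i - int k)" and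
    c2: "\<And>d. d \<ge> 2 \<Longrightarrow> c d = 0" and c1: "c 1 = 1"
    using constant_diagonals[OF n Q Q0 eq] by blast
  \<comment> \<open>W is the sum of the terms \<open>c d\<close> J^(d-1): \<lambda>^(-l) e_ik has
    degree i - k - n l = d - 1. That \<open>c d\<close> vanishes for d >= 2 is what lets W be a
    power series.\<close>
  define W where "W = mat n n (\<lambda>(i, k). Abs_fps (\<lambda>l. c (int i + 1 - int k - int n * int l)))"
  have Wc: "W \<in> carrier_mat n n" by (simp add: W_def)
  have Wn: "fps_nth (W $$ (i, k)) l = c (int i + 1 - int k - int n * int l)"
    if "i < n" "k < n" for i k l using that by (simp add: W_def)
  have KWn: "fps_nth ((K_mat n * W) $$ (i, k)) l = c (int n * (1 - int l) + int i - int k)"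
    if ik: "i < n" "k < n" for i k l
  proof (cases i)
    case 0
    then show ?thesis using K_mat_mult_index(1)[OF Wc ik(2)] ik
      by (simp add: Wn of_nat_diff algebra_simps)
  next
    case (Suc i')
    note K = K_mat_mult_index(2)[OF Wc ik(2), of i']
    show ?thesis
    proof (cases l)
      case 0
      \<comment> \<open>The left-hand side is 0 because of its factor \<open>fps_X\<close>, the
        right-hand side because its degree is at least 2.\<close>
      have "c (int n + int i - int k) = 0" using ik Suc by (intro c2) auto
      then show ?thesis using K ik Suc 0 by simp
    next
      case (Suc l')
      then show ?thesis using K ik \<open>i = Suc i'\<close> by (simp add: Wn algebra_simps)
    qed
  qed
  have WKn: "fps_nth ((W * K_mat n) $$ (i, k)) l = c (int n * (1 - int l) + int i - int k)"
    if ik: "i < n" "k < n" for i k l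
  proof (cases "k = n - 1")
    case True
    then show ?thesis using mult_K_mat_index(1)[OF Wc ik(1)] ik
      by (simp add: Wn of_nat_diff algebra_simps)
  next
    case False
    then have k: "Suc k < n" using ik by simp
    note K = mult_K_mat_index(2)[OF Wc ik(1) k]
    show ?thesis
    proof (cases l)
      case 0
      have "c (int n + int i - int k) = 0" using k by (intro c2) auto
      then show ?thesis using K ik 0 by simp
    next
      case (Suc l')
      then show ?thesis using K ik k by (simp add: Wn algebra_simps)
    qed
  qed
  have QKW: "Q x = K_mat n * W"
    using Qc Wc by (intro eq_matI fps_ext) (auto simp: KWn cQ carrier_matD[OF K_mat_carrier] simp del: index_mult_mat(1))
  have WK: "K_mat n * W = W * K_mat n"
    using Wc by (intro eq_matI fps_ext)
      (auto simp: KWn WKn carrier_matD[OF K_mat_carrier] simp del: index_mult_mat(1))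
  have p: "W ^\<^sub>m n \<in> carrier_mat n n" using Wc by simp
  have "fps_X ^ (n - 1) \<cdot>\<^sub>m (1\<^sub>m n :: real fps mat) = K_mat n ^\<^sub>m n * W ^\<^sub>m n"
    using pow[of x] unfolding QKW commuting_mult_pow[OF K_mat_carrier Wc WK] by simp
  also have "\<dots> = fps_X ^ (n - 1) \<cdot>\<^sub>m W ^\<^sub>m n"
    unfolding K_mat_pow_n[OF n0] by (simp only: square_mat_simps[where n=n] p)
  finally have e: "fps_X ^ (n - 1) \<cdot>\<^sub>m (1\<^sub>m n :: real fps mat) = fps_X ^ (n - 1) \<cdot>\<^sub>m W ^\<^sub>m n" .
  have "W ^\<^sub>m n = 1\<^sub>m n"
  proof (rule eq_matI)
    fix i k assume "i < dim_row (1\<^sub>m n :: real fps mat)" "k < dim_col (1\<^sub>m n :: real fps mat)"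
    then show "(W ^\<^sub>m n) $$ (i, k) = 1\<^sub>m n $$ (i, k)"
      using arg_cong[OF e, of "\<lambda>A. A $$ (i, k)"] carrier_matD[OF Wc] by (auto split: if_splits)
  qed (use p in auto)
  moreover have "fps_nth (W $$ (i, k)) 0 = (if i = k then 1 else 0)" if "k \<le> i" "i < n" for i k
    using that by (simp add: Wn c1 c2)
  ultimately have "W = 1\<^sub>m n" by (intro unipotent_root_of_unity[OF Wc n0]) auto
  then show ?thesis unfolding QKW by (simp only: right_mult_one_mat[OF K_mat_carrier])
qed


text \<open>The last three facts concern P = M K N, whose powers are M K^j N: conjugation carries
  the trivial equation for K^j, which commutes with K, to the one for P^j. Uniqueness later
  transfers them to the series selected by \<open>Y_series\<close>.\<close>

lemma P_series_exists_unique: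
  assumes n: "n \<ge> 2" and u: "smooth_mat n u" and V: "\<And>x. u x \<in> V_space n"
  obtains P where "is_P_series n u P"
    "\<And>P'. is_P_series n u P' \<Longrightarrow> P' = P"
    "\<And>j x. fps_X \<cdot>\<^sub>m fps_mat_dx n (\<lambda>x. P x ^\<^sub>m j) x + commutator (L_mat n (u x)) (P x ^\<^sub>m j) = 0\<^sub>m n n"
    "\<And>j. smooth_fps_mat n (\<lambda>x. P x ^\<^sub>m j)"
    "\<And>j x. j mod n \<noteq> 0 \<Longrightarrow> tr (P x ^\<^sub>m j) = 0"
proof -
  interpret h: comm_ring_hom "\<lambda>f :: real fps. fps_nth f 0" by (rule fps_nth_0_hom)
  note sq = square_mat_simps[where n=n]
  let ?z = "map_mat (\<lambda>f :: real fps. fps_nth f 0)"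
  let ?e = "elem_mat n 0 (n - 1) :: real mat"
  have n0: "n > 0" using n by simp
  obtain M where M: "smooth_fps_mat n M"
    and M0: "\<And>x i k. k \<le> i \<Longrightarrow> i < n \<Longrightarrow> fps_nth (M x $$ (i, k)) 0 = (if i = k then 1 else 0)"
    and eqM: "\<And>x. fps_X \<cdot>\<^sub>m fps_mat_dx n M x + L_mat n (u x) * M x = M x * K_mat n"
    using dressing_matrix[OF n0 u V] by blast
  obtain N where N: "smooth_fps_mat n N" and MN: "\<And>x. M x * N x = 1\<^sub>m n" and NM: "\<And>x. N x * M x = 1\<^sub>m n"
    using fps_mat_inverse[OF M M0] by blast
  note c = smooth_fps_matD(1)[OF M] smooth_fps_matD(1)[OF N]
  have L: "L_mat n (u x) \<in> carrier_mat n n" for x using V_spaceD(1)[OF V] by simp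
  have zM: "?z (M x) \<in> carrier_mat n n" "?z (N x) \<in> carrier_mat n n" for x using c by auto
  have e: "?e \<in> carrier_mat n n" by (simp add: elem_mat_def)
  \<comment> \<open>Conjugation by the constant coefficient of M fixes e_1n. Hence P has the leading
    coefficient of \<open>K_mat n\<close>, and so does a second solution after it is conjugated
    back.\<close>
  have zMe: "?z (M x) * ?e = ?e" "?e * ?z (M x) = ?e" for x
    using c(1)[of x] M0 by (intro unitriangular_elem_mat[OF zM(1)]; simp)+
  have zNM: "?z (N x) * ?z (M x) = 1\<^sub>m n" "?z (M x) * ?z (N x) = 1\<^sub>m n" for x
    using h.mat_hom_mult[OF c(2) c(1), of x x] h.mat_hom_mult[OF c(1) c(2), of x x]
    by (simp_all add: NM MN h.mat_hom_one)
  have zNe: "?z (N x) * ?e = ?e" for x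
  proof -
    have "?z (N x) * ?e = ?z (N x) * (?z (M x) * ?e)" by (simp only: zMe)
    also have "\<dots> = (?z (N x) * ?z (M x)) * ?e" by (simp only: sq zM e)
    also have "\<dots> = ?e" by (simp only: zNM sq e)
    finally show ?thesis .
  qed
  have zeN: "?e * ?z (N x) = ?e" for x
  proof -
    have "?e * ?z (N x) = (?e * ?z (M x)) * ?z (N x)" by (simp only: zMe)
    also have "\<dots> = ?e * (?z (M x) * ?z (N x))" by (simp only: sq zM e)
    also have "\<dots> = ?e" by (simp only: zNM sq e)
    finally show ?thesis .
  qed
  have zK: "?z (K_mat n) = ?e"
    by (rule eq_matI) (auto simp: K_mat_def elem_mat_def)
  define P where "P x = M x * K_mat n * N x" for x
  have Pc: "P x \<in> carrier_mat n n" for x unfolding P_def by (simp only: sq c K_mat_carrier)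
  have Ppow: "P x ^\<^sub>m j = M x * K_mat n ^\<^sub>m j * N x" for x j
    unfolding P_def by (rule conj_pow[OF c K_mat_carrier MN NM])
  have Kj: "K_mat n ^\<^sub>m j \<in> carrier_mat n n" for j by simp
  have K_comm: "commutator (K_mat n) (K_mat n ^\<^sub>m j) = 0\<^sub>m n n" for j
  proof -
    have "K_mat n * K_mat n ^\<^sub>m j = K_mat n ^\<^sub>m j * K_mat n"
    proof (induction j)
      case (Suc j)
      have "K_mat n * K_mat n ^\<^sub>m Suc j = (K_mat n * K_mat n ^\<^sub>m j) * K_mat n"
        unfolding pow_mat.simps by (simp only: sq Kj K_mat_carrier)
      then show ?case unfolding Suc.IH by simp
    qed (simp add: carrier_matD[OF K_mat_carrier])
    moreover have "K_mat n ^\<^sub>m j * K_mat n \<in> carrier_mat n n" by (simp only: sq Kj K_mat_carrier)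
    ultimately show ?thesis unfolding commutator_def by simp
  qed
  have dPj: "fps_X \<cdot>\<^sub>m fps_mat_dx n (\<lambda>x. P x ^\<^sub>m j) x + commutator (L_mat n (u x)) (P x ^\<^sub>m j) = 0\<^sub>m n n"
    for j x
  proof -
    have "fps_X \<cdot>\<^sub>m fps_mat_dx n (\<lambda>x. P x ^\<^sub>m j) x + commutator (L_mat n (u x)) (P x ^\<^sub>m j)
        = M x * (fps_X \<cdot>\<^sub>m 0\<^sub>m n n + commutator (K_mat n) (K_mat n ^\<^sub>m j)) * N x"
      unfolding Ppow
      using fps_mat_conj_commutator[OF M N smooth_fps_mat_const[OF Kj] L K_mat_carrier MN NM eqM, of j x]
      by simp
    also have "\<dots> = 0\<^sub>m n n"
      unfolding K_comm using c(1)[of x] c(2)[of x] by simp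
    finally show ?thesis .
  qed
  have sPj: "smooth_fps_mat n (\<lambda>x. P x ^\<^sub>m j)" for j
    unfolding Ppow by (intro smooth_fps_mat_mult M N smooth_fps_mat_const Kj)
  have trP: "tr (P x ^\<^sub>m j) = 0" if "j mod n \<noteq> 0" for j x
  proof -
    have "tr (P x ^\<^sub>m j) = tr (M x * (K_mat n ^\<^sub>m j * N x))"
      unfolding Ppow by (simp only: sq c Kj)
    also have "\<dots> = tr ((K_mat n ^\<^sub>m j * N x) * M x)"
      by (rule tr_mult_comm[of _ n]) (simp_all only: sq c Kj)
    also have "(K_mat n ^\<^sub>m j * N x) * M x = K_mat n ^\<^sub>m j"
      by (simp only: sq c Kj NM)
    finally show ?thesis using tr_K_mat_pow[OF that] by simp
  qed
  have P1: "P x ^\<^sub>m 1 = P x" for x using Pc[of x] by simp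
  have "P x ^\<^sub>m n = fps_X ^ (n - 1) \<cdot>\<^sub>m 1\<^sub>m n" for x
    unfolding Ppow K_mat_pow_n[OF n0] by (simp only: sq c MN)
  moreover have "?z (P x) = ?e" for x
  proof -
    have "?z (P x) = ?z (M x) * ?z (K_mat n) * ?z (N x)"
      unfolding P_def h.mat_hom_mult[OF mult_carrier_mat[OF c(1) K_mat_carrier] c(2)]
        h.mat_hom_mult[OF c(1) K_mat_carrier] ..
    then show ?thesis by (simp only: zK zMe zeN)
  qed
  ultimately have "is_P_series n u P"
    using sPj[of 1] dPj[of 1] unfolding is_P_series_def P1 by blast
  moreover have "P' = P" if "is_P_series n u P'" for P'
  proof
    fix x
    have P': "smooth_fps_mat n P'" and z: "\<And>x. ?z (P' x) = ?e"
      and eq: "\<And>x. fps_X \<cdot>\<^sub>m fps_mat_dx n P' x + commutator (L_mat n (u x)) (P' x) = 0\<^sub>m n n"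
      and pow: "\<And>x. P' x ^\<^sub>m n = fps_X ^ (n - 1) \<cdot>\<^sub>m 1\<^sub>m n"
      using that unfolding is_P_series_def by blast+
    note c' = smooth_fps_matD(1)[OF P']
    define Q where "Q x = N x * P' x * M x" for x
    have Q: "smooth_fps_mat n Q" unfolding Q_def by (intro smooth_fps_mat_mult M N P')
    note cQ = smooth_fps_matD(1)[OF Q]
    have MQN: "M x * Q x * N x = P' x" for x
    proof -
      have "M x * Q x * N x = (M x * N x) * P' x * (M x * N x)"
        unfolding Q_def by (simp only: sq c c')
      then show ?thesis unfolding MN by (simp only: sq c')
    qed
    have "fps_X \<cdot>\<^sub>m fps_mat_dx n Q x + commutator (K_mat n) (Q x) = 0\<^sub>m n n" (is "?D x = _") for x
    proof -
      have D: "?D x \<in> carrier_mat n n"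
        unfolding commutator_def by (simp only: sq cQ K_mat_carrier fps_mat_dx_carrier)
      have "M x * ?D x * N x = 0\<^sub>m n n"
        using fps_mat_conj_commutator[OF M N Q L K_mat_carrier MN NM eqM, of x]
        unfolding MQN eq by simp
      then have "N x * (M x * ?D x * N x) * M x = 0\<^sub>m n n"
        using c(1)[of x] c(2)[of x] by simp
      moreover have "N x * (M x * ?D x * N x) * M x = (N x * M x) * ?D x * (N x * M x)"
        by (simp only: sq(1,5) c D)
      ultimately show ?thesis unfolding NM by (simp only: sq D)
    qed
    moreover have "?z (Q x) = ?e" for x
    proof -
      have "?z (Q x) = ?z (N x) * ?z (P' x) * ?z (M x)"
        unfolding Q_def h.mat_hom_mult[OF mult_carrier_mat[OF c(2) c'] c(1)]
          h.mat_hom_mult[OF c(2) c'] ..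
      then show ?thesis by (simp only: z zMe zNe)
    qed
    moreover have "Q x ^\<^sub>m n = fps_X ^ (n - 1) \<cdot>\<^sub>m 1\<^sub>m n" for x
      unfolding Q_def conj_pow[OF c(2) c(1) c' NM MN] pow by (simp only: sq c NM)
    ultimately have "Q x = K_mat n" by (intro undressed_unique[OF n Q])
    then show "P' x = P x" using MQN[of x] unfolding P_def by simp
  qed
  ultimately show ?thesis using that[of P] dPj sPj trP by blast
qed

section \<open>The series \<open>Y(u,\<lambda>)\<close>\<close>

text \<open>\<open>A\<close> is a series in \<lambda>^(-1), and \<open>j\<close> bounds the powers
  of \<lambda> after embedding. With Y = \<lambda> P these bounds add up in products, so the
  \<lambda>^0 coefficient of Y^j is coefficient j of P^j.\<close>

definition lam_embed :: "nat \<Rightarrow> real fps mat \<Rightarrow> real fls mat" where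
  "lam_embed j A = lam ^ j \<cdot>\<^sub>m map_mat fps_to_fls A"

lemma fps_to_fls_hom: "comm_ring_hom (fps_to_fls :: real fps \<Rightarrow> real fls)"
  by unfold_locales (auto simp: fls_times_fps_to_fls)

lemma lam_embed_carrier [simp]: "A \<in> carrier_mat n m \<Longrightarrow> lam_embed j A \<in> carrier_mat n m"
  by (simp add: lam_embed_def)

lemma lam_pow_nth: "fls_nth (lam ^ j * fps_to_fls f) (- i)
    = (if i > int j then 0 else fps_nth f (nat (int j - i)))"
  by (simp add: lam_def fls_X_inv_power_times_conv_shift)

lemma lam_coeff_embed:
  "lam_coeff i (lam_embed j A) =
    (if i > int j then 0\<^sub>m (dim_row A) (dim_col A) else map_mat (\<lambda>f. fps_nth f (nat (int j - i))) A)"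
  by (rule eq_matI) (auto simp: lam_coeff_def lam_embed_def lam_pow_nth)

lemma lam_embed_mult:
  assumes A: "A \<in> carrier_mat n n" and B: "B \<in> carrier_mat n n"
  shows "lam_embed a A * lam_embed b B = lam_embed (a + b) (A * B)"
proof -
  interpret h: comm_ring_hom "fps_to_fls :: real fps \<Rightarrow> real fls" by (rule fps_to_fls_hom)
  have c: "map_mat fps_to_fls A \<in> carrier_mat n n" "map_mat fps_to_fls B \<in> carrier_mat n n"
    using A B by auto
  show ?thesis
    unfolding lam_embed_def h.mat_hom_mult[OF A B]
      mult_smult_assoc_mat[OF c(1) smult_carrier_mat[OF c(2)]] mult_smult_distrib[OF c]
    by (rule eq_matI) (auto simp: power_add mult_ac simp del: index_mult_mat(1))
qed

lemma lam_embed_minus: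
  assumes A: "A \<in> carrier_mat n n" and B: "B \<in> carrier_mat n n"
  shows "lam_embed a (A - B) = lam_embed a A - lam_embed a B"
  using assms unfolding lam_embed_def by (intro eq_matI) (auto simp: algebra_simps)

lemma lam_embed_pow:
  assumes A: "A \<in> carrier_mat n n"
  shows "lam_embed 1 A ^\<^sub>m j = lam_embed j (A ^\<^sub>m j)"
proof (induction j)
  case 0
  then show ?case using A unfolding lam_embed_def by (intro eq_matI) auto
next
  case (Suc j)
  then show ?case using lam_embed_mult[OF pow_carrier_mat[OF A] A, of j j 1] by simp
qed

lemma J_mat_embed:
  assumes "u \<in> carrier_mat n n" and "n > 0"
  shows "J_mat n + map_mat fls_const u = lam_embed 1 (L_mat n u)"
proof -
  have [simp]: "fls_X_inv * fls_X = (1 :: real fls)"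
    by (simp add: fls_X_inv_times_conv_shift fls_X_conv_shift_1)
  have [simp]: "fls_X_inv * (fls_X * a) = (a :: real fls)" for a
    by (simp add: mult.assoc[symmetric])
  show ?thesis
    using assms
    by (intro eq_matI)
       (auto simp: lam_embed_def L_mat_def J_mat_def K_mat_def lam_def elem_mat_def b_mat_def
         fls_times_fps_to_fls distrib_left)
qed

text \<open>Both factors of [J + u, Y] contain one \<lambda>, so the equation is divided by
  \<lambda>^2; Y_x contains a single one, which leaves \<open>fps_X\<close> in front of the
  derivative of P. Likewise Y^n = \<lambda> turns into P^n = \<open>fps_X ^ (n - 1)\<close>.\<close>

lemma is_Y_series_embed:
  assumes n: "n > 0" and u: "\<And>x. u x \<in> carrier_mat n n" and Pc: "\<And>x. P x \<in> carrier_mat n n"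
  shows "is_Y_series n u (\<lambda>x. lam_embed 1 (P x)) \<longleftrightarrow> is_P_series n u P \<and> (\<forall>x. tr (P x) = 0)"
proof -
  have L: "L_mat n (u x) \<in> carrier_mat n n" for x using u by simp
  have d: "dim_row (P x) = n" "dim_col (P x) = n" for x using Pc[of x] by auto
  have comm: "commutator (J_mat n + map_mat fls_const (u x)) (lam_embed 1 (P x))
      = lam_embed 2 (commutator (L_mat n (u x)) (P x))" for x
  proof -
    note sq = square_mat_simps[where n=n]
    have "lam_embed 2 (commutator (L_mat n (u x)) (P x))
        = lam_embed 2 (L_mat n (u x) * P x) - lam_embed 2 (P x * L_mat n (u x))"
      unfolding commutator_def by (rule lam_embed_minus[of _ n]) (simp_all only: sq L Pc)
    then show ?thesis
      unfolding J_mat_embed[OF u n] commutator_def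
        lam_embed_mult[OF L Pc] lam_embed_mult[OF Pc L] one_add_one by simp
  qed
  have Cc: "commutator (L_mat n (u x)) (P x) \<in> carrier_mat n n" for x
    unfolding commutator_def by (simp only: square_mat_simps[where n=n] L Pc)
  have c1: "lam_coeff i (lam_embed 1 (P x))
      = (if i > 1 then 0\<^sub>m n n else map_mat (\<lambda>f. fps_nth f (nat (1 - i))) (P x))" for i x
    by (simp add: lam_coeff_embed d)
  have c2: "lam_coeff i (lam_embed 2 (commutator (L_mat n (u x)) (P x)))
      = (if i > 2 then 0\<^sub>m n n
         else map_mat (\<lambda>f. fps_nth f (nat (2 - i))) (commutator (L_mat n (u x)) (P x)))" for i x
    by (simp add: lam_coeff_embed carrier_matD[OF Cc])
  have sm: "(\<forall>i. smooth_mat n (\<lambda>x. lam_coeff i (lam_embed 1 (P x)))) \<longleftrightarrow> smooth_fps_mat n P"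
  proof
    assume s: "\<forall>i. smooth_mat n (\<lambda>x. lam_coeff i (lam_embed 1 (P x)))"
    have "smooth_fun (\<lambda>x. fps_nth (P x $$ (i, k)) m)" if "i < n" "k < n" for i k m
      using s[rule_format, of "1 - int m"] that unfolding smooth_mat_def c1 by (simp add: d)
    then show "smooth_fps_mat n P" using Pc by (simp add: smooth_fps_mat_def smooth_fps_def)
  next
    assume s: "smooth_fps_mat n P"
    show "\<forall>i. smooth_mat n (\<lambda>x. lam_coeff i (lam_embed 1 (P x)))"
    proof
      fix i
      show "smooth_mat n (\<lambda>x. lam_coeff i (lam_embed 1 (P x)))"
        using s Pc unfolding smooth_mat_def c1 smooth_fps_mat_def smooth_fps_def
        by (cases "i > 1") (auto simp: d)
    qed
  qed
  have trc: "(\<forall>i x. (\<Sum>k<n. lam_coeff i (lam_embed 1 (P x)) $$ (k, k)) = 0) \<longleftrightarrow> (\<forall>x. tr (P x) = 0)"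
  proof
    assume a: "\<forall>i x. (\<Sum>k<n. lam_coeff i (lam_embed 1 (P x)) $$ (k, k)) = 0"
    have "fps_nth (tr (P x)) m = 0" for x m
      using a[rule_format, of "1 - int m" x] unfolding c1 tr_def by (simp add: d fps_sum_nth)
    then show "\<forall>x. tr (P x) = 0" by (auto intro: fps_ext)
  next
    assume "\<forall>x. tr (P x) = 0"
    then have "fps_nth (tr (P x)) m = 0" for x m by simp
    then show "\<forall>i x. (\<Sum>k<n. lam_coeff i (lam_embed 1 (P x)) $$ (k, k)) = 0"
      unfolding c1 tr_def by (auto simp: d fps_sum_nth)
  qed
  have ode: "(\<forall>i. mat_deriv n (\<lambda>y. lam_coeff i (lam_embed 1 (P y))) x
        + lam_coeff i (commutator (J_mat n + map_mat fls_const (u x)) (lam_embed 1 (P x))) = 0\<^sub>m n n)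
      \<longleftrightarrow> fps_X \<cdot>\<^sub>m fps_mat_dx n P x + commutator (L_mat n (u x)) (P x) = 0\<^sub>m n n" for x
  proof -
    define C where "C = commutator (L_mat n (u x)) (P x)"
    have C: "C \<in> carrier_mat n n" unfolding C_def by (rule Cc)
    have e: "(mat_deriv n (\<lambda>y. lam_coeff i (lam_embed 1 (P y))) x + lam_coeff i (lam_embed 2 C)) $$ (r, k)
        = (if i > 2 then 0 else fps_nth ((fps_X \<cdot>\<^sub>m fps_mat_dx n P x + C) $$ (r, k)) (nat (2 - i)))"
      if "r < n" "k < n" for r k i
    proof -
      have s: "nat (2 - i) - Suc 0 = nat (1 - i)" by simp
      show ?thesis
        using that C unfolding c2[of i x, folded C_def] mat_deriv_def c1
        by (auto simp: d fps_mat_dx_def s)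
    qed
    have car: "mat_deriv n (\<lambda>y. lam_coeff i (lam_embed 1 (P y))) x + lam_coeff i (lam_embed 2 C) \<in> carrier_mat n n" for i
      using C by (simp add: mat_deriv_def lam_coeff_def)
    have car2: "fps_X \<cdot>\<^sub>m fps_mat_dx n P x + C \<in> carrier_mat n n" using C by simp
    show ?thesis unfolding comm C_def[symmetric]
    proof
      assume a: "\<forall>i. mat_deriv n (\<lambda>y. lam_coeff i (lam_embed 1 (P y))) x + lam_coeff i (lam_embed 2 C) = 0\<^sub>m n n"
      show "fps_X \<cdot>\<^sub>m fps_mat_dx n P x + C = 0\<^sub>m n n"
      proof (rule eq_matI)
        fix r k assume "r < dim_row (0\<^sub>m n n :: real fps mat)" "k < dim_col (0\<^sub>m n n :: real fps mat)"
        then have rk: "r < n" "k < n" by auto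
        have "fps_nth ((fps_X \<cdot>\<^sub>m fps_mat_dx n P x + C) $$ (r, k)) m = 0" for m
          using e[OF rk, of "2 - int m"] a rk by simp
        then show "(fps_X \<cdot>\<^sub>m fps_mat_dx n P x + C) $$ (r, k) = 0\<^sub>m n n $$ (r, k)"
          using rk by (auto intro: fps_ext)
      qed (use car2 in auto)
    next
      assume a: "fps_X \<cdot>\<^sub>m fps_mat_dx n P x + C = 0\<^sub>m n n"
      show "\<forall>i. mat_deriv n (\<lambda>y. lam_coeff i (lam_embed 1 (P y))) x + lam_coeff i (lam_embed 2 C) = 0\<^sub>m n n"
      proof
        fix i
        show "mat_deriv n (\<lambda>y. lam_coeff i (lam_embed 1 (P y))) x + lam_coeff i (lam_embed 2 C) = 0\<^sub>m n n"
          using e[of _ _ i] carrier_matD[OF car[of i]] unfolding a by (intro eq_matI) auto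
      qed
    qed
  qed
  have pw: "lam_embed 1 (P x) ^\<^sub>m n = lam \<cdot>\<^sub>m 1\<^sub>m n \<longleftrightarrow> P x ^\<^sub>m n = fps_X ^ (n - 1) \<cdot>\<^sub>m 1\<^sub>m n" for x
  proof -
    have lx: "(lam ^ m * fls_X ^ m :: real fls) = 1" for m
      by (simp add: power_mult_distrib[symmetric] lam_def fls_X_inv_times_conv_shift fls_X_conv_shift_1)
    have "lam ^ n * fps_to_fls (fps_X ^ (n - 1)) = (lam :: real fls)"
    proof -
      obtain m where m: "n = Suc m" using n gr0_implies_Suc by blast
      show ?thesis using lx[of m] by (simp add: m fps_to_fls_power mult.assoc)
    qed
    then have e: "lam \<cdot>\<^sub>m 1\<^sub>m n = lam_embed n (fps_X ^ (n - 1) \<cdot>\<^sub>m 1\<^sub>m n)"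
      unfolding lam_embed_def by (intro eq_matI) auto
    have l0: "lam ^ n \<noteq> 0" by (simp add: lam_def)
    have "lam_embed n A = lam_embed n B \<longleftrightarrow> A = B"
      if "A \<in> carrier_mat n n" "B \<in> carrier_mat n n" for A B
    proof
      assume a: "lam_embed n A = lam_embed n B"
      show "A = B"
      proof (rule eq_matI)
        fix i k assume "i < dim_row B" "k < dim_col B"
        then show "A $$ (i, k) = B $$ (i, k)"
          using arg_cong[OF a, of "\<lambda>A. A $$ (i, k)"] that l0 by (simp add: lam_embed_def)
      qed (use that in auto)
    qed simp
    then show ?thesis unfolding lam_embed_pow[OF Pc] e using Pc by simp
  qed
  have c11: "lam_coeff 1 (lam_embed 1 (P x)) = map_mat (\<lambda>f. fps_nth f 0) (P x)" for x
    unfolding c1 by simp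
  have hd: "\<forall>i x. i > 1 \<longrightarrow> lam_coeff i (lam_embed 1 (P x)) = 0\<^sub>m n n"
    unfolding c1 by simp
  have ode': "(\<forall>i x. mat_deriv n (\<lambda>y. lam_coeff i (lam_embed 1 (P y))) x
        + lam_coeff i (commutator (J_mat n + map_mat fls_const (u x)) (lam_embed 1 (P x))) = 0\<^sub>m n n)
      \<longleftrightarrow> (\<forall>x. fps_X \<cdot>\<^sub>m fps_mat_dx n P x + commutator (L_mat n (u x)) (P x) = 0\<^sub>m n n)"
    using ode by blast
  show ?thesis
    unfolding is_Y_series_def is_P_series_def sm trc pw c11 ode'
    using hd lam_embed_carrier[OF Pc] by blast
qed

text \<open>Since no power above \<lambda>^1 occurs, \<lambda>^(-1) Y is a power series; this
  reduces the uniqueness of Y to that of P.\<close>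

lemma Y_series_is_embed:
  assumes "is_Y_series n u Y"
  obtains P where "Y = (\<lambda>x. lam_embed 1 (P x))" "\<And>x. P x \<in> carrier_mat n n"
proof -
  have Yc: "Y x \<in> carrier_mat n n" and Y1: "i > 1 \<Longrightarrow> lam_coeff i (Y x) = 0\<^sub>m n n" for x i
    using assms unfolding is_Y_series_def by blast+
  define P where "P x = mat n n (\<lambda>(i, k). Abs_fps (\<lambda>m. fls_nth (Y x $$ (i, k)) (int m - 1)))" for x
  have "Y x = lam_embed 1 (P x)" for x
  proof (rule eq_matI)
    fix i k assume "i < dim_row (lam_embed 1 (P x))" "k < dim_col (lam_embed 1 (P x))"
    then have ik: "i < n" "k < n" by (auto simp: P_def lam_embed_def)
    show "Y x $$ (i, k) = lam_embed 1 (P x) $$ (i, k)"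
    proof (rule fls_eqI)
      fix t
      have neg: "fls_nth (Y x $$ (i, k)) t = 0" if "t < -1"
        using arg_cong[OF Y1[of "- t" x], of "\<lambda>A. A $$ (i, k)"] that ik Yc[of x]
        by (simp add: lam_coeff_def)
      have "lam_embed 1 (P x) $$ (i, k) = lam ^ 1 * fps_to_fls (P x $$ (i, k))"
        using ik by (simp add: lam_embed_def P_def)
      then have "fls_nth (lam_embed 1 (P x) $$ (i, k)) (- (- t))
          = (if - t > 1 then 0 else fps_nth (P x $$ (i, k)) (nat (1 + t)))"
        using lam_pow_nth[of 1 "P x $$ (i, k)" "- t"] by simp
      then show "fls_nth (Y x $$ (i, k)) t = fls_nth (lam_embed 1 (P x) $$ (i, k)) t"
        using neg ik by (auto simp: P_def)
    qed
  qed (use Yc[of x] in \<open>auto simp: P_def lam_embed_def\<close>)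
  then have "Y = (\<lambda>x. lam_embed 1 (P x))" by blast
  moreover have "P x \<in> carrier_mat n n" for x by (simp add: P_def)
  ultimately show ?thesis by (rule that)
qed

lemma Y_coeff_series:
  assumes n: "n \<ge> 2" and u: "smooth_mat n u" and V: "\<And>x. u x \<in> V_space n"
  obtains P where
    "\<And>j x. fps_X \<cdot>\<^sub>m fps_mat_dx n (\<lambda>x. P x ^\<^sub>m j) x + commutator (L_mat n (u x)) (P x ^\<^sub>m j) = 0\<^sub>m n n"
    "\<And>j. smooth_fps_mat n (\<lambda>x. P x ^\<^sub>m j)"
    "\<And>j x. j mod n \<noteq> 0 \<Longrightarrow> tr (P x ^\<^sub>m j) = 0"
    "\<And>j. Y_coeff n j 0 u = (\<lambda>x. map_mat (\<lambda>f. fps_nth f j) (P x ^\<^sub>m j))"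
proof -
  have n0: "n > 0" using n by simp
  have uc: "u x \<in> carrier_mat n n" for x using V_spaceD(1)[OF V] .
  obtain P where P: "is_P_series n u P"
    and uniq: "\<And>P'. is_P_series n u P' \<Longrightarrow> P' = P"
    and 1: "\<And>j x. fps_X \<cdot>\<^sub>m fps_mat_dx n (\<lambda>x. P x ^\<^sub>m j) x + commutator (L_mat n (u x)) (P x ^\<^sub>m j) = 0\<^sub>m n n"
    and 2: "\<And>j. smooth_fps_mat n (\<lambda>x. P x ^\<^sub>m j)"
    and 3: "\<And>j x. j mod n \<noteq> 0 \<Longrightarrow> tr (P x ^\<^sub>m j) = 0"
    using P_series_exists_unique[OF n u V] by blast
  have Pc: "P x \<in> carrier_mat n n" for x
    using P unfolding is_P_series_def smooth_fps_mat_def by blast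
  \<comment> \<open>The trace condition of \<open>is_Y_series\<close> is the case j = 1, since n >=
    2 does not divide 1.\<close>
  have "tr (P x) = 0" for x using 3[of 1 x] n Pc[of x] by simp
  then have Y: "is_Y_series n u (\<lambda>x. lam_embed 1 (P x))"
    using is_Y_series_embed[of n u P, OF n0 uc Pc] P by blast
  have Ys: "Y_series n u = (\<lambda>x. lam_embed 1 (P x))"
    unfolding Y_series_def
  proof (rule the_equality[of "is_Y_series n u"])
    fix Y assume Y': "is_Y_series n u Y"
    obtain P' where P': "Y = (\<lambda>x. lam_embed 1 (P' x))" "\<And>x. P' x \<in> carrier_mat n n"
      using Y_series_is_embed[OF Y'] by blast
    have "is_P_series n u P'" using is_Y_series_embed[of n u P', OF n0 uc P'(2)] Y'[unfolded P'(1)] by blast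
    then show "Y = (\<lambda>x. lam_embed 1 (P x))" using uniq P' by simp
  qed (rule Y)
  have "Y_coeff n j 0 u = (\<lambda>x. map_mat (\<lambda>f. fps_nth f j) (P x ^\<^sub>m j))" for j
    unfolding Y_coeff_def[abs_def] Ys lam_embed_pow[OF Pc] lam_coeff_embed by simp
  then show ?thesis using that[of P] 1 2 3 by blast
qed


section \<open>The strictly upper triangular correction\<close>

text \<open>\<open>L_mat n u\<close> is e_1n + \<open>fps_X\<close> (b + u), so a coefficient of a
  product involves two consecutive coefficients of \<open>A\<close>.\<close>

lemma L_mat_coeff:
  assumes u: "u \<in> carrier_mat n n" and A: "A \<in> carrier_mat n n" and ik: "i < n" "k < n"
  shows "fps_nth ((L_mat n u * A) $$ (i, k)) (Suc m)
      = (elem_mat n 0 (n - 1) * map_mat (\<lambda>f. fps_nth f (Suc m)) A) $$ (i, k)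
        + ((b_mat n + u) * map_mat (\<lambda>f. fps_nth f m) A) $$ (i, k)"
    "fps_nth ((A * L_mat n u) $$ (i, k)) (Suc m)
      = (map_mat (\<lambda>f. fps_nth f (Suc m)) A * elem_mat n 0 (n - 1)) $$ (i, k)
        + (map_mat (\<lambda>f. fps_nth f m) A * (b_mat n + u)) $$ (i, k)"
proof -
  let ?A = "\<lambda>m. map_mat (\<lambda>f. fps_nth f m) A"
  let ?e = "elem_mat n 0 (n - 1) :: real mat"
  have c: "?e \<in> carrier_mat n n" "b_mat n + u \<in> carrier_mat n n" "?A m \<in> carrier_mat n n" for m
    using u A by (auto simp: elem_mat_def b_mat_def)
  have Lil: "L_mat n u $$ (i, l)
      = fps_const (?e $$ (i, l)) + fps_X * fps_const ((b_mat n + u) $$ (i, l))" if "i < n" "l < n" for i l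
    using that u by (auto simp: L_mat_def K_mat_def elem_mat_def b_mat_def distrib_left
        fps_const_add[symmetric] simp del: fps_const_add)
  have "fps_nth ((L_mat n u * A) $$ (i, k)) (Suc m)
      = (\<Sum>l<n. ?e $$ (i, l) * ?A (Suc m) $$ (l, k) + (b_mat n + u) $$ (i, l) * ?A m $$ (l, k))"
    unfolding mult_mat_index[OF L_mat_carrier[OF u] A ik] fps_sum_nth
    using ik A c by (intro sum.cong) (simp_all add: Lil distrib_right mult.assoc)
  then show "fps_nth ((L_mat n u * A) $$ (i, k)) (Suc m)
      = (?e * ?A (Suc m)) $$ (i, k) + ((b_mat n + u) * ?A m) $$ (i, k)"
    unfolding mult_mat_index[OF c(1) c(3) ik] mult_mat_index[OF c(2) c(3) ik]
    by (simp only: sum.distrib)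
  have "fps_nth ((A * L_mat n u) $$ (i, k)) (Suc m)
      = (\<Sum>l<n. ?A (Suc m) $$ (i, l) * ?e $$ (l, k) + ?A m $$ (i, l) * (b_mat n + u) $$ (l, k))"
    unfolding mult_mat_index[OF A L_mat_carrier[OF u] ik] fps_sum_nth
  proof (rule sum.cong)
    fix l assume "l \<in> {..<n}"
    then have l: "l < n" by simp
    have "A $$ (i, l) * L_mat n u $$ (l, k)
      = fps_const (?e $$ (l, k)) * A $$ (i, l) + fps_X * (fps_const ((b_mat n + u) $$ (l, k)) * A $$ (i, l))"
      unfolding Lil[OF l ik(2)] by (simp only: algebra_simps)
    then show "fps_nth (A $$ (i, l) * L_mat n u $$ (l, k)) (Suc m)
        = ?A (Suc m) $$ (i, l) * ?e $$ (l, k) + ?A m $$ (i, l) * (b_mat n + u) $$ (l, k)"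
      using l ik A by (simp add: mult.commute)
  qed simp
  then show "fps_nth ((A * L_mat n u) $$ (i, k)) (Suc m)
      = (?A (Suc m) * ?e) $$ (i, k) + (?A m * (b_mat n + u)) $$ (i, k)"
    unfolding mult_mat_index[OF c(3) c(1) ik] mult_mat_index[OF c(3) c(2) ik]
    by (simp only: sum.distrib)
qed

text \<open>The \<lambda>^0 coefficient of the equation for Y^j reads [d/dx + b + u, Y_{j,0}] =
  [Y_{j,-1}, e_1n]. The right-hand side lives in the first row and the last column, hence not
  strictly below the diagonal.\<close>

lemma Y_coeff_properties:
  assumes n: "n \<ge> 2" and u: "smooth_mat n u" and V: "\<And>x. u x \<in> V_space n" and j: "j mod n \<noteq> 0"
  shows "smooth_mat n (Y_coeff n j 0 u)"
    "(\<Sum>i<n. Y_coeff n j 0 u x $$ (i, i)) = 0"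
    "k < i \<Longrightarrow> i < n \<Longrightarrow>
      (mat_deriv n (Y_coeff n j 0 u) x + commutator (b_mat n + u x) (Y_coeff n j 0 u x)) $$ (i, k) = 0"
proof -
  obtain P where
    eq: "\<And>j x. fps_X \<cdot>\<^sub>m fps_mat_dx n (\<lambda>x. P x ^\<^sub>m j) x + commutator (L_mat n (u x)) (P x ^\<^sub>m j) = 0\<^sub>m n n"
    and sm: "\<And>j. smooth_fps_mat n (\<lambda>x. P x ^\<^sub>m j)"
    and tr0: "\<And>j x. j mod n \<noteq> 0 \<Longrightarrow> tr (P x ^\<^sub>m j) = 0"
    and Y: "\<And>j. Y_coeff n j 0 u = (\<lambda>x. map_mat (\<lambda>f. fps_nth f j) (P x ^\<^sub>m j))"
    using Y_coeff_series[OF n u V] by blast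
  define A where "A x = P x ^\<^sub>m j" for x
  have A: "smooth_fps_mat n A" unfolding A_def by (rule sm)
  note Ac = smooth_fps_matD(1)[OF A]
  have d: "dim_row (A x) = n" "dim_col (A x) = n" for x using Ac[of x] by auto
  have uc: "u x \<in> carrier_mat n n" for x using V_spaceD(1)[OF V] .
  have Yj: "Y_coeff n j 0 u = (\<lambda>x. map_mat (\<lambda>f. fps_nth f j) (A x))" unfolding Y A_def ..
  show "smooth_mat n (Y_coeff n j 0 u)"
    using A unfolding Yj smooth_mat_def smooth_fps_mat_def smooth_fps_def by (auto simp: d)
  show "(\<Sum>i<n. Y_coeff n j 0 u x $$ (i, i)) = 0"
    using arg_cong[OF tr0[OF j, of x], of "\<lambda>f. fps_nth f j"]
    unfolding Yj A_def[symmetric] tr_def by (simp add: d fps_sum_nth)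
  assume ik: "k < i" "i < n"
  then have k: "k < n" by simp
  let ?e = "elem_mat n 0 (n - 1) :: real mat"
  let ?A = "\<lambda>m. map_mat (\<lambda>f. fps_nth f m) (A x)"
  have c: "?e \<in> carrier_mat n n" "b_mat n + u x \<in> carrier_mat n n" "?A m \<in> carrier_mat n n" for m
    using uc[of x] Ac[of x] by (auto simp: elem_mat_def b_mat_def)
  have "(fps_X \<cdot>\<^sub>m fps_mat_dx n A x + commutator (L_mat n (u x)) (A x)) $$ (i, k) = 0"
    using eq[of j x, folded A_def] ik k by simp
  then have "fps_X * fps_mat_dx n A x $$ (i, k)
      + ((L_mat n (u x) * A x) $$ (i, k) - (A x * L_mat n (u x)) $$ (i, k)) = 0"
    using ik k d[of x] carrier_matD[OF L_mat_carrier[OF uc[of x]]] carrier_matD[OF fps_mat_dx_carrier[of n A x]]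
    unfolding commutator_def by (simp del: index_mult_mat(1))
  \<comment> \<open>The equation for Y^j has been divided by \<lambda>^(j+1), so its \<lambda>^0
    coefficient sits at \<open>Suc j\<close>.\<close>
  then have "fps_nth (fps_X * fps_mat_dx n A x $$ (i, k)) (Suc j)
      + (fps_nth ((L_mat n (u x) * A x) $$ (i, k)) (Suc j)
         - fps_nth ((A x * L_mat n (u x)) $$ (i, k)) (Suc j)) = 0"
    by (metis fps_add_nth fps_sub_nth fps_zero_nth)
  then have "deriv (\<lambda>y. fps_nth (A y $$ (i, k)) j) x
      + (((?e * ?A (Suc j)) $$ (i, k) + ((b_mat n + u x) * ?A j) $$ (i, k))
        - ((?A (Suc j) * ?e) $$ (i, k) + (?A j * (b_mat n + u x)) $$ (i, k))) = 0"
    unfolding L_mat_coeff[OF uc Ac ik(2) k] using ik k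
    by (simp add: fps_mat_dx_def del: index_mult_mat(1))
  moreover have "(?e * ?A (Suc j)) $$ (i, k) = 0"
    unfolding mult_mat_index[OF c(1) c(3) ik(2) k]
    using ik by (intro sum.neutral) (auto simp: elem_mat_def)
  moreover have "(?A (Suc j) * ?e) $$ (i, k) = 0"
    unfolding mult_mat_index[OF c(3) c(1) ik(2) k]
    using ik by (intro sum.neutral) (auto simp: elem_mat_def)
  ultimately have "deriv (\<lambda>y. fps_nth (A y $$ (i, k)) j) x
      + (((b_mat n + u x) * ?A j) $$ (i, k) - (?A j * (b_mat n + u x)) $$ (i, k)) = 0" by simp
  then show "(mat_deriv n (Y_coeff n j 0 u) x
      + commutator (b_mat n + u x) (Y_coeff n j 0 u x)) $$ (i, k) = 0"
    unfolding Yj commutator_def using ik k c(2) carrier_matD[OF uc[of x]]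
    by (simp add: mat_deriv_def d b_mat_def del: index_mult_mat(1))
qed

lemma bu_mult_index:
  fixes Z :: "real mat"
  assumes u: "u \<in> V_space n" and Z: "Z \<in> carrier_mat n n" and ik: "i < n" "k < n"
  shows "((b_mat n + u) * Z) $$ (i, k) = (if i > 0 then Z $$ (i - 1, k) else 0) + u $$ (i, n - 1) * Z $$ (n - 1, k)"
proof -
  have uc: "u \<in> carrier_mat n n" using V_spaceD(1)[OF u] .
  have c: "b_mat n + u \<in> carrier_mat n n" using uc by (simp add: b_mat_def)
  have "((b_mat n + u) * Z) $$ (i, k) = (\<Sum>l<n. (if l = i - 1 then if i > 0 then Z $$ (i - 1, k) else 0 else 0)
      + (if l = n - 1 then u $$ (i, n - 1) * Z $$ (n - 1, k) else 0))"
    unfolding mult_mat_index[OF c Z ik]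
  proof (rule sum.cong)
    fix l assume l: "l \<in> {..<n}"
    have "(b_mat n + u) $$ (i, l) = (if i = Suc l then 1 else 0) + (if l = n - 1 then u $$ (i, n - 1) else 0)"
      using l ik uc V_spaceD(2)[OF u ik(1), of l] by (auto simp: b_mat_def)
    then show "(b_mat n + u) $$ (i, l) * Z $$ (l, k) = (if l = i - 1 then if i > 0 then Z $$ (i - 1, k) else 0 else 0)
      + (if l = n - 1 then u $$ (i, n - 1) * Z $$ (n - 1, k) else 0)"
      using l by (auto simp: distrib_right)
  qed simp
  also have "\<dots> = (if i > 0 then Z $$ (i - 1, k) else 0) + u $$ (i, n - 1) * Z $$ (n - 1, k)"
    using ik by (simp add: sum.distrib)
  finally show ?thesis .
qed

lemma mult_bu_index:
  fixes Z :: "real mat"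
  assumes u: "u \<in> V_space n" and Z: "Z \<in> carrier_mat n n" and i: "i < n" and k: "Suc k < n"
  shows "(Z * (b_mat n + u)) $$ (i, k) = Z $$ (i, Suc k)"
proof -
  have uc: "u \<in> carrier_mat n n" using V_spaceD(1)[OF u] .
  have c: "b_mat n + u \<in> carrier_mat n n" using uc by (simp add: b_mat_def)
  have "(Z * (b_mat n + u)) $$ (i, k) = (\<Sum>l<n. if l = Suc k then Z $$ (i, Suc k) else 0)"
    unfolding mult_mat_index[OF Z c i Suc_lessD[OF k]]
    using k uc V_spaceD(2)[OF u, of _ k] by (intro sum.cong) (auto simp: b_mat_def)
  then show ?thesis using k by simp
qed

text \<open>The columns of the matrix \<open>Z\<close> with first column \<open>A e\<^sub>1\<close>.\<close>

fun flow_column :: "nat \<Rightarrow> (real \<Rightarrow> real mat) \<Rightarrow> (real \<Rightarrow> real mat) \<Rightarrow> nat \<Rightarrow> nat \<Rightarrow> real \<Rightarrow> real" where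
  "flow_column n u A 0 i x = A x $$ (i, 0)"
| "flow_column n u A (Suc k) i x = deriv (flow_column n u A k i) x
     + ((if i > 0 then flow_column n u A k (i - 1) x else 0)
        + u x $$ (i, n - 1) * flow_column n u A k (n - 1) x)"

lemma smooth_flow_column:
  assumes n: "n > 0" and u: "smooth_mat n u" and A: "smooth_mat n A"
  shows "i < n \<Longrightarrow> smooth_fun (flow_column n u A k i)"
proof (induction k arbitrary: i)
  case 0
  then show ?case using A n by (simp add: smooth_mat_def)
next
  case (Suc k)
  have "smooth_fun (\<lambda>x. u x $$ (i, n - 1))" using u Suc.prems n by (simp add: smooth_mat_def)
  moreover have "smooth_fun (\<lambda>x. if i > 0 then flow_column n u A k (i - 1) x else 0)"
    using Suc by (cases "i > 0") simp_all
  moreover have "smooth_fun (flow_column n u A k (n - 1))" using Suc.IH n by simp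
  ultimately have "smooth_fun (\<lambda>x. deriv (flow_column n u A k i) x
     + ((if i > 0 then flow_column n u A k (i - 1) x else 0)
        + u x $$ (i, n - 1) * flow_column n u A k (n - 1) x))"
    using Suc by (intro smooth_fun_add smooth_fun_mult smooth_fun_deriv)
  then show ?case by (simp only: flow_column.simps)
qed

lemma covariant_deriv_index:
  assumes u: "u x \<in> V_space n" and Z: "Z x \<in> carrier_mat n n" and i: "i < n" and k: "Suc k < n"
  shows "(mat_deriv n Z x + commutator (b_mat n + u x) (Z x)) $$ (i, k)
    = deriv (\<lambda>y. Z y $$ (i, k)) x + ((if i > 0 then Z x $$ (i - 1, k) else 0)
        + u x $$ (i, n - 1) * Z x $$ (n - 1, k)) - Z x $$ (i, Suc k)"
proof -
  have k': "k < n" using k by simp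
  have uc: "u x \<in> carrier_mat n n" using V_spaceD(1)[OF u] .
  have "(mat_deriv n Z x + commutator (b_mat n + u x) (Z x)) $$ (i, k)
    = deriv (\<lambda>y. Z y $$ (i, k)) x
      + (((b_mat n + u x) * Z x) $$ (i, k) - (Z x * (b_mat n + u x)) $$ (i, k))"
    using i k' uc Z unfolding commutator_def
    by (simp add: mat_deriv_def b_mat_def del: index_mult_mat(1))
  then show ?thesis unfolding bu_mult_index[OF u Z i k'] mult_bu_index[OF u Z i k] by simp
qed

lemma covariant_deriv_column:
  assumes V: "\<And>x. u x \<in> V_space n" and Z: "\<And>x. Z x \<in> carrier_mat n n"
    and ZV: "\<And>x. mat_deriv n Z x + commutator (b_mat n + u x) (Z x) \<in> V_space n"
    and i: "i < n" and k: "Suc k < n"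
  shows "Z x $$ (i, Suc k) = deriv (\<lambda>y. Z y $$ (i, k)) x
     + ((if i > 0 then Z x $$ (i - 1, k) else 0) + u x $$ (i, n - 1) * Z x $$ (n - 1, k))"
  using V_spaceD(2)[OF ZV[of x] i, of k] covariant_deriv_index[of u x n Z i k, OF V Z i k] k by simp

text \<open>The candidate is \<zeta> = Y_{j,0} - Z with Z grown from the first column of Y_{j,0}. It
  is strictly upper triangular because both matrices obey the same column recursion on and below the
  diagonal. It is unique because a strictly upper triangular \<zeta> has zero first column, so every
  admissible Z starts from the same column.\<close>

lemma is_zeta_zeta:
  assumes n: "n \<ge> 2" and u: "smooth_mat n u" and V: "\<And>x. u x \<in> V_space n" and j: "j mod n \<noteq> 0"
  shows "is_zeta n j u (zeta n j u)"
proof -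
  define A where "A = Y_coeff n j 0 u"
  have A: "smooth_mat n A" and trA: "\<And>x. (\<Sum>i<n. A x $$ (i, i)) = 0"
    and up: "\<And>x i k. k < i \<Longrightarrow> i < n \<Longrightarrow>
      (mat_deriv n A x + commutator (b_mat n + u x) (A x)) $$ (i, k) = 0"
    unfolding A_def using Y_coeff_properties[OF n u V j] by auto
  have Ac: "A x \<in> carrier_mat n n" for x using A by (simp add: smooth_mat_def)
  have n0: "n > 0" using n by simp
  let ?f = "flow_column n u A"
  define Z where "Z x = mat n n (\<lambda>(i, k). ?f k i x)" for x
  have Zc: "Z x \<in> carrier_mat n n" for x by (simp add: Z_def)
  have Zi: "Z x $$ (i, k) = ?f k i x" if "i < n" "k < n" for x i k using that by (simp add: Z_def)
  \<comment> \<open>For k + 1 <= i the recursion refers only to entries on or below the diagonal,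
    where \<open>up\<close> shows that \<open>A\<close> satisfies it too.\<close>
  have low: "?f k i = (\<lambda>x. A x $$ (i, k))" if "k \<le> i" "i < n" for k i
    using that
  proof (induction k arbitrary: i)
    case 0
    then show ?case by auto
  next
    case (Suc k)
    have "?f k i = (\<lambda>x. A x $$ (i, k))" "?f k (i - 1) = (\<lambda>x. A x $$ (i - 1, k))"
      "?f k (n - 1) = (\<lambda>x. A x $$ (n - 1, k))"
      using Suc by (auto intro!: Suc.IH)
    note f = this
    have k: "Suc k < n" "k < i" using Suc.prems by auto
    show ?case
    proof
      fix x
      show "?f (Suc k) i x = A x $$ (i, Suc k)"
        using up[OF k(2) Suc.prems(2), of x] k
          covariant_deriv_index[of u x n A i k, OF V Ac Suc.prems(2) k(1)]
        unfolding flow_column.simps f by simp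
    qed
  qed
  define \<zeta> where "\<zeta> x = A x - Z x" for x
  have Z\<zeta>: "A x - \<zeta> x = Z x" for x
    using Ac[of x] Zc[of x] unfolding \<zeta>_def by (intro eq_matI) auto
  have \<zeta>c: "\<zeta> x \<in> carrier_mat n n" for x using Zc unfolding \<zeta>_def by (intro minus_carrier_mat)
  have smZ: "smooth_fun (\<lambda>x. Z x $$ (i, k))" if "i < n" "k < n" for i k
    using smooth_flow_column[OF n0 u A that(1)] by (simp add: Zi that)
  have "smooth_fun (\<lambda>x. \<zeta> x $$ (i, k))" if "i < n" "k < n" for i k
  proof -
    have "(\<lambda>x. \<zeta> x $$ (i, k)) = (\<lambda>x. A x $$ (i, k) - Z x $$ (i, k))"
      using that unfolding \<zeta>_def by (simp add: carrier_matD[OF Zc])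
    then show ?thesis using smZ[OF that] A that by (simp add: smooth_fun_diff smooth_mat_def)
  qed
  then have 1: "smooth_mat n \<zeta>" using \<zeta>c by (simp add: smooth_mat_def)
  have diag: "\<zeta> x $$ (i, k) = 0" if "i < n" "k \<le> i" for x i k
    using that low[OF that(2,1)] Zc[of x] unfolding \<zeta>_def by (simp add: Zi)
  then have 2: "strictly_upper n (\<zeta> x)" for x using \<zeta>c by (simp add: strictly_upper_def)
  have 3: "mat_deriv n Z x + commutator (b_mat n + u x) (Z x) \<in> V_space n" (is "?D \<in> _") for x
  proof -
    have uc: "u x \<in> carrier_mat n n" using V_spaceD(1)[OF V] .
    have buc: "b_mat n + u x \<in> carrier_mat n n" using uc by (simp add: b_mat_def)
    have D: "?D \<in> carrier_mat n n"
      unfolding mat_deriv_def commutator_def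
      by (simp only: square_mat_simps[where n=n] mat_carrier Zc buc)
    have col: "?D $$ (i, k) = 0" if "i < n" "Suc k < n" for i k
      using covariant_deriv_index[of u x n Z i k, OF V Zc that] that Suc_lessD[OF that(2)] n0 by (simp add: Zi)
    \<comment> \<open>V_n excludes the corner entry. All earlier columns of \<open>?D\<close>
      vanish, so the corner equals the trace of \<open>?D\<close>; this is 0 because Z has the
      diagonal of the traceless \<open>A\<close> and a commutator is traceless.\<close>
    have "(\<Sum>i<n. ?D $$ (i, i)) = 0"
    proof -
      have "(\<Sum>i<n. Z y $$ (i, i)) = 0" for y
      proof -
        have "Z y $$ (i, i) = A y $$ (i, i)" if "i < n" for i
          using low[OF le_refl that] that by (simp add: Zi)
        then show ?thesis using trA[of y] by simp
      qed
      then have "deriv (\<lambda>y. \<Sum>i<n. Z y $$ (i, i)) x = 0" by simp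
      moreover have "deriv (\<lambda>y. \<Sum>i<n. Z y $$ (i, i)) x = (\<Sum>i<n. deriv (\<lambda>y. Z y $$ (i, i)) x)"
        by (intro DERIV_imp_deriv DERIV_sum smooth_fun_has_deriv smZ) auto
      ultimately have t1: "(\<Sum>i<n. deriv (\<lambda>y. Z y $$ (i, i)) x) = 0" by simp
      have t2: "tr ((b_mat n + u x) * Z x) = tr (Z x * (b_mat n + u x))"
        by (rule tr_mult_comm[OF buc Zc])
      have "?D $$ (i, i) = deriv (\<lambda>y. Z y $$ (i, i)) x + (((b_mat n + u x) * Z x) $$ (i, i)
          - (Z x * (b_mat n + u x)) $$ (i, i))" if "i < n" for i
        using that uc Zc[of x] unfolding commutator_def
        by (simp add: mat_deriv_def b_mat_def del: index_mult_mat(1))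
      then have "(\<Sum>i<n. ?D $$ (i, i)) = (\<Sum>i<n. deriv (\<lambda>y. Z y $$ (i, i)) x)
          + ((\<Sum>i<n. ((b_mat n + u x) * Z x) $$ (i, i)) - (\<Sum>i<n. (Z x * (b_mat n + u x)) $$ (i, i)))"
        by (simp add: sum.distrib sum_subtractf del: index_mult_mat(1))
      also have "\<dots> = 0"
        using t1 t2 Zc[of x] uc unfolding tr_def by (simp add: b_mat_def del: index_mult_mat(1))
      finally show ?thesis .
    qed
    moreover have "(\<Sum>i<n. ?D $$ (i, i)) = ?D $$ (n - 1, n - 1)"
    proof -
      have "(\<Sum>i<Suc (n - 1). ?D $$ (i, i)) = ?D $$ (n - 1, n - 1)"
        unfolding sum.lessThan_Suc using col by (subst sum.neutral) auto
      then show ?thesis using n0 by simp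
    qed
    ultimately have corner: "?D $$ (n - 1, n - 1) = 0" by simp
    have "i < n - 1 \<and> k = n - 1" if "i < n" "k < n" "?D $$ (i, k) \<noteq> 0" for i k
    proof -
      have "k = n - 1" using col[OF that(1), of k] that(2,3) by (cases "Suc k < n") auto
      moreover have "i \<noteq> n - 1" using corner that(3) calculation by auto
      ultimately show ?thesis using that(1) by auto
    qed
    then show ?thesis using D unfolding V_space_def by blast
  qed
  have ex: "is_zeta n j u \<zeta>"
    unfolding is_zeta_def A_def[symmetric] Z\<zeta> using 1 2 3 by blast
  have "\<zeta>' = \<zeta>" if "is_zeta n j u \<zeta>'" for \<zeta>'
  proof
    fix x
    define Z' where "Z' x = A x - \<zeta>' x" for x
    have s: "\<And>x. strictly_upper n (\<zeta>' x)"
      and ZV: "\<And>x. mat_deriv n Z' x + commutator (b_mat n + u x) (Z' x) \<in> V_space n"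
      using that unfolding is_zeta_def A_def[symmetric] Z'_def[symmetric] by auto
    have \<zeta>'c: "\<zeta>' x \<in> carrier_mat n n" for x using s by (simp add: strictly_upper_def)
    have Z'c: "Z' x \<in> carrier_mat n n" for x using \<zeta>'c unfolding Z'_def by (intro minus_carrier_mat)
    have col: "(\<lambda>x. Z' x $$ (i, k)) = ?f k i" if "i < n" "k < n" for i k
      using that
    proof (induction k arbitrary: i)
      case 0
      have "\<zeta>' x $$ (i, 0) = 0" for x using s[of x] 0 by (simp add: strictly_upper_def)
      then show ?case using 0 unfolding Z'_def by (auto simp: carrier_matD[OF \<zeta>'c])
    next
      case (Suc k)
      note IH = Suc.IH[OF _ Suc_lessD[OF Suc.prems(2)]]
      have IHx: "Z' x $$ (i, k) = ?f k i x" if "i < n" for i x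
        using IH[OF that] by (rule fun_cong)
      show ?case
        using covariant_deriv_column[of u n Z' i k, OF V Z'c ZV Suc.prems] Suc.prems n0
        by (auto simp: IHx IH)
    qed
    show "\<zeta>' x = \<zeta> x"
    proof (rule eq_matI)
      fix i k assume "i < dim_row (\<zeta> x)" "k < dim_col (\<zeta> x)"
      then have ik: "i < n" "k < n" using \<zeta>c[of x] by auto
      have "Z' x $$ (i, k) = Z x $$ (i, k)" using fun_cong[OF col[OF ik], of x] Zi[OF ik] by simp
      then show "\<zeta>' x $$ (i, k) = \<zeta> x $$ (i, k)"
        using ik \<zeta>'c[of x] Zc[of x] unfolding Z'_def \<zeta>_def by simp
    qed (use \<zeta>c[of x] \<zeta>'c[of x] in auto)
  qed
  with ex show ?thesis unfolding zeta_def by (rule theI)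
qed


section \<open>Central affine curves\<close>

lemma smooth_fun_det:
  assumes "\<And>x. A x \<in> carrier_mat n n" "\<And>i k. i < n \<Longrightarrow> k < n \<Longrightarrow> smooth_fun (\<lambda>x. A x $$ (i, k))"
  shows "smooth_fun (\<lambda>x. det (A x))"
proof -
  have "smooth_fun (\<lambda>x. \<Prod>i = 0..<n. A x $$ (i, p i))" if "p permutes {0..<n}" for p
    using that assms(2) by (intro smooth_fun_prod) (auto dest: permutes_in_image)
  then show ?thesis
    unfolding det_def'[OF assms(1)]
    by (intro smooth_fun_sum smooth_fun_mult smooth_fun_const) auto
qed

text \<open>The Leibniz expansion is differentiated one column at a time. Applied to the frame,
  whose determinant is constant, this removes one coordinate of the n-th derivative of the
  curve.\<close>

lemma det_has_derivative:
  assumes A: "smooth_mat n A"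
  shows "((\<lambda>x. det (A x)) has_field_derivative
    (\<Sum>k<n. det (replace_col (A x) (col (mat_deriv n A x) k) k))) (at x)"
proof -
  have Ac: "A x \<in> carrier_mat n n" for x using A by (simp add: smooth_mat_def)
  have d: "dim_row (A x) = n" "dim_col (A x) = n" for x using Ac[of x] by auto
  let ?R = "\<lambda>k. replace_col (A x) (col (mat_deriv n A x) k) k"
  have Rc: "?R k \<in> carrier_mat n n" for k by (simp add: replace_col_def d)
  have "((\<lambda>x. \<Sum>p | p permutes {0..<n}. signof p * (\<Prod>l<n. A x $$ (p l, l))) has_field_derivative
      (\<Sum>p | p permutes {0..<n}. signof p *
        (\<Sum>k<n. deriv (\<lambda>y. A y $$ (p k, k)) x * (\<Prod>l\<in>{..<n} - {k}. A x $$ (p l, l))))) (at x)"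
  proof (intro DERIV_sum DERIV_cmult has_field_derivative_prod)
    fix p k assume "p \<in> {p. p permutes {0..<n}}" "k \<in> {..<n}"
    then have "p k < n" "k < n" by (auto dest: permutes_in_image)
    then show "((\<lambda>y. A y $$ (p k, k)) has_field_derivative deriv (\<lambda>y. A y $$ (p k, k)) x) (at x)"
      using A by (intro smooth_fun_has_deriv) (simp add: smooth_mat_def)
  qed
  also have "(\<Sum>p | p permutes {0..<n}. signof p *
        (\<Sum>k<n. deriv (\<lambda>y. A y $$ (p k, k)) x * (\<Prod>l\<in>{..<n} - {k}. A x $$ (p l, l))))
      = (\<Sum>k<n. det (?R k))"
  proof -
    have R: "(\<Prod>l<n. ?R k $$ (p l, l))
        = deriv (\<lambda>y. A y $$ (p k, k)) x * (\<Prod>l\<in>{..<n} - {k}. A x $$ (p l, l))"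
      if p: "p permutes {0..<n}" and k: "k < n" for p k
    proof -
      have pl: "p l < n" if "l < n" for l using p that permutes_in_image[OF p, of l] by simp
      have "(\<Prod>l<n. ?R k $$ (p l, l)) = ?R k $$ (p k, k) * (\<Prod>l\<in>{..<n} - {k}. ?R k $$ (p l, l))"
        using k by (intro prod.remove) auto
      moreover have "?R k $$ (p k, k) = deriv (\<lambda>y. A y $$ (p k, k)) x"
        using k pl[OF k] by (simp add: replace_col_def d mat_deriv_def)
      moreover have "(\<Prod>l\<in>{..<n} - {k}. ?R k $$ (p l, l)) = (\<Prod>l\<in>{..<n} - {k}. A x $$ (p l, l))"
        using pl by (intro prod.cong) (auto simp: replace_col_def d)
      ultimately show ?thesis by simp
    qed
    show ?thesis
      unfolding det_col[OF Rc] sum_distrib_left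
      by (subst sum.swap) (intro sum.cong refl, auto simp: R)
  qed
  finally show ?thesis by (simp only: det_col[OF Ac])
qed

section \<open>Moving frame and curvature\<close>

lemma frame_carrier [simp]: "frame n \<gamma> x \<in> carrier_mat n n"
  by (rule carrier_matI) (simp_all add: frame_def frame_cols_def)

lemma frame_index:
  assumes "i < n" "k < n"
  shows "frame n \<gamma> x $$ (i, k) = (deriv ^^ k) (\<lambda>y. \<gamma> y $ i) x"
  using assms by (simp add: frame_def frame_cols_def mat_of_cols_def vec_deriv_def)

lemma smooth_fun_funpow: "smooth_fun f \<Longrightarrow> smooth_fun ((deriv ^^ k) f)"
  by (induction k) (auto intro: smooth_fun_deriv)

lemma smooth_frame: "smooth_vec n \<gamma> \<Longrightarrow> smooth_mat n (frame n \<gamma>)"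
  unfolding smooth_mat_def smooth_vec_def by (auto simp: frame_index intro!: smooth_fun_funpow)

lemma frame_deriv_index:
  assumes "i < n" "k < n"
  shows "deriv (\<lambda>y. frame n \<gamma> y $$ (i, k)) x = (deriv ^^ Suc k) (\<lambda>y. \<gamma> y $ i) x"
proof -
  have "(\<lambda>y. frame n \<gamma> y $$ (i, k)) = (deriv ^^ k) (\<lambda>y. \<gamma> y $ i)"
    using assms by (intro ext frame_index)
  then show ?thesis by simp
qed

text \<open>Puts the summands of \<open>tangent_at\<close> into the form required by Cramer's
  rule.\<close>

lemma mat_of_cols_update:
  assumes "i < n" "v \<in> carrier_vec n"
  shows "mat_of_cols n ((frame_cols n \<gamma> x)[i := v]) = replace_col (frame n \<gamma> x) v i"
  using assms by (intro eq_matI)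
    (auto simp: replace_col_def frame_def frame_cols_def mat_of_cols_def nth_list_update)

text \<open>As \<open>det (g x) = 1\<close>, the adjugate inverts the frame and yields the
  coordinates of the n-th derivative in it. By Cramer's rule these are determinants of smooth
  entries, hence smooth.\<close>

lemma central_affine_curvature_properties:
  assumes n: "n \<ge> 2" and \<gamma>: "\<gamma> \<in> central_affine_curves n"
  defines "u \<equiv> central_affine_curvature n \<gamma>" and "g \<equiv> frame n \<gamma>"
  shows "u x \<in> V_space n" "smooth_mat n u" "mat_deriv n g x = g x * (b_mat n + u x)"
proof -
  have sv: "smooth_vec n \<gamma>" and det1: "\<And>x. det (g x) = 1"
    using \<gamma> by (auto simp: central_affine_curves_def g_def)
  have gc: "g x \<in> carrier_mat n n" for x by (simp add: g_def)
  have gs: "smooth_mat n g" unfolding g_def by (rule smooth_frame[OF sv])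
  have dg: "dim_row (g x) = n" "dim_col (g x) = n" for x using gc[of x] by auto
  define w where "w x = vec_deriv n n \<gamma> x" for x
  have wc: "w x \<in> carrier_vec n" for x by (simp add: w_def vec_deriv_def)
  define a where "a x = adj_mat (g x) *\<^sub>v w x" for x
  have adj: "adj_mat (g x) \<in> carrier_mat n n" "g x * adj_mat (g x) = 1\<^sub>m n" "adj_mat (g x) * g x = 1\<^sub>m n" for x
    using adj_mat[OF gc, of x] det1[of x] by auto
  have ac: "a x \<in> carrier_vec n" for x unfolding a_def using adj(1) wc by (intro mult_mat_vec_carrier)
  have ga: "g x *\<^sub>v a x = w x" for x
    unfolding a_def using assoc_mult_mat_vec[OF gc adj(1) wc, of x x x] wc[of x] by (simp add: adj)
  have a_uniq: "v = a x" if "v \<in> carrier_vec n" "g x *\<^sub>v v = w x" for v x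
  proof -
    have "v = (adj_mat (g x) * g x) *\<^sub>v v" using that by (simp add: adj)
    also have "\<dots> = a x" unfolding a_def using that assoc_mult_mat_vec[OF adj(1) gc, of v x x] by simp
    finally show ?thesis .
  qed
  have a_det: "a x $ k = det (replace_col (g x) (w x) k)" if "k < n" for x k
    using cramer_lemma_mat[OF gc ac that, of x x] by (simp add: ga det1)
  have mdg: "mat_deriv n g x $$ (i, k) = (if Suc k < n then g x $$ (i, Suc k) else w x $ i)"
    if "i < n" "k < n" for x i k
  proof -
    have d: "mat_deriv n g x $$ (i, k) = (deriv ^^ Suc k) (\<lambda>y. \<gamma> y $ i) x"
      using that frame_deriv_index[OF that, of \<gamma> x] by (simp add: mat_deriv_def g_def)
    show ?thesis
    proof (cases "Suc k < n")
      case True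
      then show ?thesis using that d by (simp add: g_def frame_index del: funpow.simps)
    next
      case False
      then have "Suc k = n" using that by simp
      then show ?thesis using that d by (simp add: w_def vec_deriv_def del: funpow.simps)
    qed
  qed
  \<comment> \<open>Differentiating \<open>det (g x) = 1\<close> leaves only the term with the n-th
    derivative in the last column, and by Cramer's rule that determinant is the last
    coordinate.\<close>
  have a0: "a x $ (n - 1) = 0" for x
  proof -
    have "(\<Sum>k<n. det (replace_col (g x) (col (mat_deriv n g x) k) k)) = 0"
      using det_has_derivative[OF gs, of x] unfolding det1 by (rule DERIV_unique) simp
    \<comment> \<open>The derivative of column k is column k + 1, so two columns coincide.\<close>
    moreover have "det (replace_col (g x) (col (mat_deriv n g x) k) k) = 0" if k: "Suc k < n" for k
    proof (rule det_identical_columns[of _ n k "Suc k"])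
      show "col (replace_col (g x) (col (mat_deriv n g x) k) k) k
          = col (replace_col (g x) (col (mat_deriv n g x) k) k) (Suc k)"
        using k mdg[of _ k x] by (intro eq_vecI) (auto simp: replace_col_def dg mat_deriv_def)
    qed (use k in \<open>auto simp: replace_col_def dg\<close>)
    moreover have "col (mat_deriv n g x) (n - 1) = w x"
      using n mdg[of _ "n - 1" x] wc[of x] by (intro eq_vecI) (auto simp: mat_deriv_def)
    moreover have "(\<Sum>k<n. f k) = (\<Sum>k<n - 1. f k) + f (n - 1)" for f :: "nat \<Rightarrow> real"
    proof -
      have "(\<Sum>k<Suc (n - 1). f k) = (\<Sum>k<n - 1. f k) + f (n - 1)" by (rule sum.lessThan_Suc)
      then show ?thesis using n by simp
    qed
    ultimately have "det (replace_col (g x) (w x) (n - 1)) = 0" by simp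
    then show ?thesis using a_det[of "n - 1" x] n by simp
  qed
  define U where "U x = mat n n (\<lambda>(i, k). if k = n - 1 then a x $ i else 0)" for x
  have UV: "U x \<in> V_space n" for x
    using a0[of x] by (auto simp: V_space_def U_def split: if_splits intro: le_neq_implies_less)
  have lin: "(\<forall>r<n. vec_deriv n n \<gamma> x $ r = (\<Sum>i<n - 1. v $$ (i, n - 1) * vec_deriv n i \<gamma> x $ r))
      \<longleftrightarrow> g x *\<^sub>v vec n (\<lambda>i. v $$ (i, n - 1)) = w x" if v: "v \<in> V_space n" for v x
  proof -
    have "(g x *\<^sub>v vec n (\<lambda>i. v $$ (i, n - 1))) $ r = (\<Sum>i<n - 1. v $$ (i, n - 1) * vec_deriv n i \<gamma> x $ r)"
      if r: "r < n" for r
    proof -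
      have "(g x *\<^sub>v vec n (\<lambda>i. v $$ (i, n - 1))) $ r = (\<Sum>i<Suc (n - 1). g x $$ (r, i) * v $$ (i, n - 1))"
        using r n dg by (simp add: scalar_prod_def lessThan_atLeast0)
      also have "\<dots> = (\<Sum>i<n - 1. g x $$ (r, i) * v $$ (i, n - 1))"
        unfolding sum.lessThan_Suc using V_spaceD(3)[OF v] n by simp
      also have "\<dots> = (\<Sum>i<n - 1. v $$ (i, n - 1) * vec_deriv n i \<gamma> x $ r)"
        using r by (intro sum.cong) (auto simp: g_def frame_index vec_deriv_def)
      finally show ?thesis .
    qed
    then show ?thesis
      unfolding w_def using dg by (auto simp: vec_eq_iff vec_deriv_def)
  qed
  have veq: "vec n (\<lambda>i. U x $$ (i, n - 1)) = a x" for x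
    using n ac[of x] by (intro eq_vecI) (auto simp: U_def)
  have uU: "u x = U x" for x
    unfolding u_def central_affine_curvature_def
  proof (rule the_equality)
    show "U x \<in> V_space n \<and> (\<forall>r<n. vec_deriv n n \<gamma> x $ r
        = (\<Sum>i<n - 1. U x $$ (i, n - 1) * vec_deriv n i \<gamma> x $ r))"
      using UV lin[OF UV] veq ga by simp
  next
    fix v assume v: "v \<in> V_space n \<and> (\<forall>r<n. vec_deriv n n \<gamma> x $ r
        = (\<Sum>i<n - 1. v $$ (i, n - 1) * vec_deriv n i \<gamma> x $ r))"
    then have vV: "v \<in> V_space n" by blast
    have "vec n (\<lambda>i. v $$ (i, n - 1)) = a x" using v lin[OF vV] by (intro a_uniq) auto
    then have va: "v $$ (i, n - 1) = a x $ i" if "i < n" for i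
      using that by (metis index_vec)
    show "v = U x"
    proof (rule eq_matI)
      fix i k assume "i < dim_row (U x)" "k < dim_col (U x)"
      then have ik: "i < n" "k < n" by (auto simp: U_def)
      show "v $$ (i, k) = U x $$ (i, k)"
        using ik va[of i] V_spaceD(2)[OF vV ik(1), of k] by (cases "k = n - 1") (auto simp: U_def)
    qed (use V_spaceD(1)[OF vV] in \<open>auto simp: U_def\<close>)
  qed
  show V: "u x \<in> V_space n" using UV by (simp add: uU)
  have "smooth_fun (\<lambda>x. a x $ k)" if k: "k < n" for k
  proof -
    have "smooth_fun (\<lambda>x. det (replace_col (g x) (w x) k))"
    proof (rule smooth_fun_det)
      fix i l assume il: "i < n" "l < n"
      have "smooth_fun (\<lambda>x. w x $ i)"
        using sv il unfolding w_def smooth_vec_def vec_deriv_def by (auto intro!: smooth_fun_funpow)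
      moreover have "smooth_fun (\<lambda>x. g x $$ (i, l))" using gs il by (simp add: smooth_mat_def)
      ultimately show "smooth_fun (\<lambda>x. replace_col (g x) (w x) k $$ (i, l))"
        using il by (cases "l = k") (auto simp: replace_col_def dg)
    qed (simp add: replace_col_def dg)
    then show ?thesis by (simp add: a_det[OF k])
  qed
  then have "smooth_fun (\<lambda>x. U x $$ (i, k))" if "i < n" "k < n" for i k
    using that by (cases "k = n - 1") (simp_all add: U_def)
  then have "smooth_mat n U" by (simp add: smooth_mat_def U_def)
  then show "smooth_mat n u" using uU by (metis ext)
  show "mat_deriv n g x = g x * (b_mat n + u x)"
  proof (rule eq_matI)
    have uc: "u x \<in> carrier_mat n n" using V_spaceD(1)[OF V] .
    have buc: "b_mat n + u x \<in> carrier_mat n n" using uc by (simp add: b_mat_def)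
    fix i k assume "i < dim_row (g x * (b_mat n + u x))" "k < dim_col (g x * (b_mat n + u x))"
    then have ik: "i < n" "k < n" using uc by (auto simp: dg)
    show "mat_deriv n g x $$ (i, k) = (g x * (b_mat n + u x)) $$ (i, k)"
    proof (cases "Suc k < n")
      case True
      then show ?thesis using mult_bu_index[OF V gc ik(1) True, of x] mdg[OF ik, of x] by simp
    next
      case False
      then have k: "k = n - 1" using ik by simp
      have "(g x * (b_mat n + u x)) $$ (i, k) = (\<Sum>l<n. g x $$ (i, l) * a x $ l)"
        unfolding mult_mat_index[OF gc buc ik]
        using n uc by (intro sum.cong) (auto simp: uU U_def k b_mat_def)
      also have "\<dots> = (g x *\<^sub>v a x) $ i"
        using ik ac[of x] by (simp add: dg scalar_prod_def lessThan_atLeast0)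
      finally show ?thesis using mdg[OF ik, of x] False by (simp add: ga)
    qed
  qed (use V_spaceD(1)[OF V] in \<open>auto simp: mat_deriv_def dg\<close>)
qed

section \<open>Tangency of the flow field\<close>

lemma tangent_at_flow:
  assumes n: "n \<ge> 2" and \<gamma>: "\<gamma> \<in> central_affine_curves n" and Z: "smooth_mat n Z"
    and ZV: "\<And>x. mat_deriv n Z x + commutator (b_mat n + central_affine_curvature n \<gamma> x) (Z x) \<in> V_space n"
    and trZ: "\<And>x. (\<Sum>i<n. Z x $$ (i, i)) = 0"
  shows "tangent_at n \<gamma> (\<lambda>x. frame n \<gamma> x *\<^sub>v (Z x *\<^sub>v unit_vec n 0))"
proof -
  define u where "u = central_affine_curvature n \<gamma>"
  define g where "g = frame n \<gamma>"
  note cur = central_affine_curvature_properties[OF n \<gamma>, folded u_def g_def]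
  have sv: "smooth_vec n \<gamma>" and det1: "\<And>x. det (g x) = 1"
    using \<gamma> by (auto simp: central_affine_curves_def g_def)
  have gc: "g x \<in> carrier_mat n n" for x by (simp add: g_def)
  have gs: "smooth_mat n g" unfolding g_def by (rule smooth_frame[OF sv])
  have Zc: "Z x \<in> carrier_mat n n" for x using Z by (simp add: smooth_mat_def)
  have uc: "u x \<in> carrier_mat n n" for x using V_spaceD(1)[OF cur(1)] .
  have buc: "b_mat n + u x \<in> carrier_mat n n" for x using uc by (simp add: b_mat_def)
  have sg: "smooth_fun (\<lambda>x. g x $$ (i, k))" and sZ: "smooth_fun (\<lambda>x. Z x $$ (i, k))"
    if "i < n" "k < n" for i k
    using gs Z that by (simp_all add: smooth_mat_def)
  define \<xi> where "\<xi> x = g x *\<^sub>v (Z x *\<^sub>v unit_vec n 0)" for x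
  have \<xi>c: "\<xi> x \<in> carrier_vec n" for x
    unfolding \<xi>_def using gc[of x] by (intro mult_mat_vec_carrier[of _ n n] mult_mat_vec_carrier[OF Zc]) auto
  have \<xi>0: "\<xi> x $ r = (g x * Z x) $$ (r, 0)" if "r < n" for x r
  proof -
    have "\<xi> x = (g x * Z x) *\<^sub>v unit_vec n 0"
      unfolding \<xi>_def by (rule assoc_mult_mat_vec[OF gc Zc unit_vec_carrier, symmetric])
    then show ?thesis using that n gc[of x] Zc[of x] by (simp del: assoc_mult_mat_vec)
  qed
  \<comment> \<open>(g Z)_x = g (Z_x + (b + u) Z). Membership in V_n says that Z_x + (b + u) Z and Z
    (b + u) agree in all columns but the last, and column i of Z (b + u) is column i + 1 of
    Z.\<close>
  have step: "deriv (\<lambda>x. (g x * Z x) $$ (r, i)) x = (g x * Z x) $$ (r, Suc i)"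
    if r: "r < n" and i: "Suc i < n" for r i x
  proof -
    have i': "i < n" using i by simp
    have "(\<lambda>x. (g x * Z x) $$ (r, i)) = (\<lambda>x. \<Sum>l<n. g x $$ (r, l) * Z x $$ (l, i))"
      by (simp only: mult_mat_index[OF gc Zc r i'])
    moreover have "deriv (\<lambda>x. \<Sum>l<n. g x $$ (r, l) * Z x $$ (l, i)) x
        = (\<Sum>l<n. mat_deriv n g x $$ (r, l) * Z x $$ (l, i) + g x $$ (r, l) * mat_deriv n Z x $$ (l, i))"
    proof (rule DERIV_imp_deriv, rule DERIV_sum)
      fix l assume "l \<in> {..<n}"
      then have l: "l < n" by simp
      show "((\<lambda>x. g x $$ (r, l) * Z x $$ (l, i)) has_field_derivative
          mat_deriv n g x $$ (r, l) * Z x $$ (l, i) + g x $$ (r, l) * mat_deriv n Z x $$ (l, i)) (at x)"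
        using DERIV_mult[OF smooth_fun_has_deriv[OF sg[OF r l], of x] smooth_fun_has_deriv[OF sZ[OF l i'], of x]]
          r l i' by (simp add: mat_deriv_def mult.commute)
    qed
    moreover have "\<dots> = (mat_deriv n g x * Z x) $$ (r, i) + (g x * mat_deriv n Z x) $$ (r, i)"
      by (simp add: mult_mat_index[OF _ Zc r i'] mult_mat_index[OF gc _ r i'] mat_deriv_def sum.distrib
          del: index_mult_mat(1))
    moreover have "(mat_deriv n g x * Z x) $$ (r, i) = (g x * ((b_mat n + u x) * Z x)) $$ (r, i)"
      unfolding cur(3) by (simp only: assoc_mult_mat[OF gc buc Zc])
    moreover have "(g x * ((b_mat n + u x) * Z x)) $$ (r, i) + (g x * mat_deriv n Z x) $$ (r, i)
        = (g x * Z x) $$ (r, Suc i)"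
    proof -
      have bZ: "(b_mat n + u x) * Z x \<in> carrier_mat n n" by (rule mult_carrier_mat[OF buc Zc])
      have dZ: "mat_deriv n Z x \<in> carrier_mat n n" by (simp add: mat_deriv_def)
      have "((b_mat n + u x) * Z x) $$ (l, i) + mat_deriv n Z x $$ (l, i) = Z x $$ (l, Suc i)"
        if l: "l < n" for l
        using covariant_deriv_column[of u n Z l i x, OF cur(1) Zc ZV[folded u_def] l i]
          bu_mult_index[OF cur(1) Zc l i', of x x] l i' by (simp add: mat_deriv_def del: index_mult_mat(1))
      then have "(\<Sum>l<n. g x $$ (r, l) * (((b_mat n + u x) * Z x) $$ (l, i) + mat_deriv n Z x $$ (l, i)))
          = (\<Sum>l<n. g x $$ (r, l) * Z x $$ (l, Suc i))"
        by (intro sum.cong) auto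
      then show ?thesis
        unfolding mult_mat_index[OF gc bZ r i'] mult_mat_index[OF gc dZ r i'] mult_mat_index[OF gc Zc r i]
        by (simp only: distrib_left sum.distrib)
    qed
    ultimately show ?thesis by simp
  qed
  have iter: "(deriv ^^ i) (\<lambda>y. \<xi> y $ r) = (\<lambda>x. (g x * Z x) $$ (r, i))" if "r < n" "i < n" for r i
    using that(2)
  proof (induction i)
    case 0
    then show ?case using \<xi>0[OF that(1)] by auto
  next
    case (Suc i)
    have "(deriv ^^ Suc i) (\<lambda>y. \<xi> y $ r) = deriv (\<lambda>x. (g x * Z x) $$ (r, i))"
      using Suc by simp
    also have "\<dots> = (\<lambda>x. (g x * Z x) $$ (r, Suc i))"
      using step[OF that(1) Suc.prems] by (rule ext)
    finally show ?case .
  qed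
  have "smooth_fun (\<lambda>x. \<xi> x $ r)" if r: "r < n" for r
  proof -
    have n0: "0 < n" using n by simp
    have "(\<lambda>x. \<xi> x $ r) = (\<lambda>x. \<Sum>l<n. g x $$ (r, l) * Z x $$ (l, 0))"
      unfolding \<xi>0[OF r] mult_mat_index[OF gc Zc r n0] ..
    then show ?thesis using sg[OF r] sZ n0 by (auto intro!: smooth_fun_sum smooth_fun_mult)
  qed
  then have "smooth_vec n \<xi>" using \<xi>c by (simp add: smooth_vec_def)
  moreover have "(\<Sum>i<n. det (mat_of_cols n ((frame_cols n \<gamma> x)[i := vec_deriv n i \<xi> x]))) = 0" for x
  proof -
    have "det (mat_of_cols n ((frame_cols n \<gamma> x)[i := vec_deriv n i \<xi> x])) = Z x $$ (i, i)"
      if i: "i < n" for i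
    proof -
      have v: "vec_deriv n i \<xi> x = g x *\<^sub>v col (Z x) i"
      proof (rule eq_vecI)
        fix r assume "r < dim_vec (g x *\<^sub>v col (Z x) i)"
        then have r: "r < n" using gc[of x] by simp
        show "vec_deriv n i \<xi> x $ r = (g x *\<^sub>v col (Z x) i) $ r"
          using r i iter[OF r i] gc[of x] Zc[of x] by (simp add: vec_deriv_def)
      qed (use gc[of x] in \<open>simp add: vec_deriv_def\<close>)
      have cZ: "col (Z x) i \<in> carrier_vec n" using Zc[of x] by (simp add: carrier_vecI)
      have "vec_deriv n i \<xi> x \<in> carrier_vec n" by (simp add: vec_deriv_def)
      then have "det (mat_of_cols n ((frame_cols n \<gamma> x)[i := vec_deriv n i \<xi> x]))
          = det (replace_col (g x) (g x *\<^sub>v col (Z x) i) i)"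
        using mat_of_cols_update[OF i] unfolding v by (simp add: g_def)
      also have "\<dots> = col (Z x) i $ i * det (g x)" by (rule cramer_lemma_mat[OF gc cZ i])
      also have "\<dots> = Z x $$ (i, i)" using i Zc[of x] by (simp add: det1)
      finally show ?thesis .
    qed
    then show ?thesis using trZ[of x] by simp
  qed
  ultimately have "tangent_at n \<gamma> \<xi>" unfolding tangent_at_def by blast
  then show ?thesis unfolding \<xi>_def[abs_def] g_def .
qed

lemma tangent_at_curve_flow_field:
  assumes n: "n \<ge> 2" and j: "j mod n \<noteq> 0" and \<gamma>: "\<gamma> \<in> central_affine_curves n"
  shows "tangent_at n \<gamma> (curve_flow_field n j \<gamma>)"
  unfolding curve_flow_field_def
proof (rule tangent_at_flow[OF n \<gamma>])
  define u where "u = central_affine_curvature n \<gamma>"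
  note cur = central_affine_curvature_properties(1,2)[OF n \<gamma>, folded u_def]
  note Y = Y_coeff_properties[OF n cur(2,1) j]
  have z: "is_zeta n j u (zeta n j u)" by (rule is_zeta_zeta[OF n cur(2,1) j])
  have s: "smooth_mat n (zeta n j u)" and up: "\<And>x. strictly_upper n (zeta n j u x)"
    and ZV: "\<And>x. mat_deriv n (Z0 n j u) x + commutator (b_mat n + u x) (Z0 n j u x) \<in> V_space n"
    using z unfolding is_zeta_def Z0_def[symmetric, abs_def] Z0_def[symmetric] by auto
  have zc: "zeta n j u x \<in> carrier_mat n n" for x using s by (simp add: smooth_mat_def)
  have Zi: "Z0 n j u x $$ (i, k) = Y_coeff n j 0 u x $$ (i, k) - zeta n j u x $$ (i, k)"
    if "i < n" "k < n" for x i k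
    using that zc[of x] by (simp add: Z0_def)
  show "smooth_mat n (Z0 n j (central_affine_curvature n \<gamma>))"
    unfolding u_def[symmetric] smooth_mat_def
  proof (intro conjI allI impI)
    show "Z0 n j u x \<in> carrier_mat n n" for x unfolding Z0_def by (rule minus_carrier_mat[OF zc])
    fix i k assume "i < n" "k < n"
    then show "smooth_fun (\<lambda>x. Z0 n j u x $$ (i, k))"
      using s Y(1) by (simp add: Zi smooth_fun_diff smooth_mat_def)
  qed
  show "mat_deriv n (Z0 n j (central_affine_curvature n \<gamma>)) x
      + commutator (b_mat n + central_affine_curvature n \<gamma> x) (Z0 n j (central_affine_curvature n \<gamma>) x)
      \<in> V_space n" for x
    using ZV unfolding u_def .
  \<comment> \<open>With zero diagonal in \<zeta>, \<open>Z0\<close> inherits the trace of Y_{j,0},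
    which vanishes as n does not divide j.\<close>
  have "zeta n j u x $$ (i, i) = 0" if "i < n" for x i
    using up[of x] that by (simp add: strictly_upper_def)
  then show "(\<Sum>i<n. Z0 n j (central_affine_curvature n \<gamma>) x $$ (i, i)) = 0" for x
    using Y(2)[of x] unfolding u_def[symmetric] by (simp add: Zi)
qed

theorem corollary2p5:
  fixes n j :: nat and \<gamma> :: "real \<Rightarrow> real vec"
    and g u :: "real \<Rightarrow> real mat"
  assumes "n \<ge> 2" and "j \<ge> 1" and "j mod n \<noteq> 0"
    and "\<gamma> \<in> central_affine_curves n"
    and "g = frame n \<gamma>" and "u = central_affine_curvature n \<gamma>"
  shows "tangent_at n \<gamma> (\<lambda>x. g x *\<^sub>v (Z0 n j u x *\<^sub>v unit_vec n 0))
    \<and> flow_equation n (curve_flow_field n j)"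
  using tangent_at_curve_flow_field[OF assms(1,3)] assms(4)
  unfolding assms(5,6) flow_equation_def curve_flow_field_def by blast

end
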